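(* Let $q=p^d$ with $p$ prime, let $n\ge 3$ be odd, and let $\langle(1,y)\rangle$ be a point of $H(n,q^2)$ (model below). Let $S_y=\{\langle(1,\omega^iy)\rangle:0\le i\le q^n\}$. Then $S_y$ is not an ovoid of $H(n,q^2)$ unless $n=3$, $q$ is even and $S_y=S_1$ (the Singer-type ovoid of $H(3,q^2)$).
   Context: $V=\mathbb{F}_{q^2}\times\mathbb{F}_{q^{2n}}$, an $(n+1)$-dimensional $\mathbb{F}_{q^2}$-space with nondegenerate Hermitian form $h((a,x),(b,y))=ab^q-\mathrm{Tr}_{\mathbb{F}_{q^{2n}}/\mathbb{F}_{q^2}}(xy^{q^n})$; $H(n,q^2)$ is the associated Hermitian polar space, whose points are $\langle v\rangle$ with $h(v,v)=0$. An ovoid is a set of points meeting each maximal totally singular subspace in exactly one point (equivalently, for $n$ odd, a set of $q^n+1$ points, no two perpendicular). $\omega$ is a fixed element of $\mathbb{F}_{q^{2n}}$ of order $q^n+1$. *)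

theory Defs
  imports
    "HOL-Computational_Algebra.Primes"
    "HOL-Library.Cardinality"
    "HOL-Library.Product_Plus"
begin

(* The field of order q^(2n) is a finite field type 'a with CARD('a) = q^(2n).  Its subfield of
   order q^2 is the fixed field of the q^2-power Frobenius map. *)

definition Fq2 :: "nat \<Rightarrow> 'a::field set" where
  "Fq2 q = {a. a ^ (q ^ 2) = a}"

(* The trace to Fq2 q: the Galois group is cyclic of order n, generated by z \<mapsto> z^(q^2). *)

definition trace_Fq2 :: "nat \<Rightarrow> nat \<Rightarrow> 'a::field \<Rightarrow> 'a" where
  "trace_Fq2 q n z = (\<Sum>i<n. z ^ (q ^ (2 * i)))"

definition herm_space :: "nat \<Rightarrow> ('a::field \<times> 'a) set" where
  "herm_space q = Fq2 q \<times> UNIV"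

definition scale_vec :: "'a::field \<Rightarrow> 'a \<times> 'a \<Rightarrow> 'a \<times> 'a" where
  "scale_vec c v = (c * fst v, c * snd v)"

definition herm :: "nat \<Rightarrow> nat \<Rightarrow> 'a::field \<times> 'a \<Rightarrow> 'a \<times> 'a \<Rightarrow> 'a" where
  "herm q n v w = fst v * fst w ^ q - trace_Fq2 q n (snd v * snd w ^ (q ^ n))"

definition Fq2_subspace :: "nat \<Rightarrow> ('a::field \<times> 'a) set \<Rightarrow> bool" where
  "Fq2_subspace q U \<longleftrightarrow> U \<subseteq> herm_space q \<and> 0 \<in> U \<and> (\<forall>u\<in>U. \<forall>v\<in>U. u + v \<in> U) \<and>
     (\<forall>c\<in>Fq2 q. \<forall>u\<in>U. scale_vec c u \<in> U)"

definition proj_point :: "nat \<Rightarrow> 'a::field \<times> 'a \<Rightarrow> ('a \<times> 'a) set" where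
  "proj_point q v = {scale_vec c v | c. c \<in> Fq2 q}"

definition hermitian_points :: "nat \<Rightarrow> nat \<Rightarrow> ('a::field \<times> 'a) set set" where
  "hermitian_points q n = {proj_point q v | v. v \<in> herm_space q \<and> v \<noteq> 0 \<and> herm q n v v = 0}"

definition totally_singular :: "nat \<Rightarrow> nat \<Rightarrow> ('a::field \<times> 'a) set \<Rightarrow> bool" where
  "totally_singular q n U \<longleftrightarrow> Fq2_subspace q U \<and> (\<forall>u\<in>U. \<forall>v\<in>U. herm q n u v = 0)"

definition maximal_totally_singular :: "nat \<Rightarrow> nat \<Rightarrow> ('a::field \<times> 'a) set \<Rightarrow> bool" where
  "maximal_totally_singular q n M \<longleftrightarrow>
     totally_singular q n M \<and> (\<forall>U. totally_singular q n U \<longrightarrow> M \<subseteq> U \<longrightarrow> U = M)"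

(* Points are one-dimensional subspaces, so incidence with a subspace is inclusion. *)

definition ovoid :: "nat \<Rightarrow> nat \<Rightarrow> ('a::field \<times> 'a) set set \<Rightarrow> bool" where
  "ovoid q n S \<longleftrightarrow> S \<subseteq> hermitian_points q n \<and>
     (\<forall>M. maximal_totally_singular q n M \<longrightarrow> (\<exists>!P. P \<in> S \<and> P \<subseteq> M))"

definition has_mult_order :: "'a::field \<Rightarrow> nat \<Rightarrow> bool" where
  "has_mult_order x k \<longleftrightarrow> 0 < k \<and> x ^ k = 1 \<and> (\<forall>m. 0 < m \<and> m < k \<longrightarrow> x ^ m \<noteq> 1)"

definition orbit_points :: "nat \<Rightarrow> nat \<Rightarrow> 'a::field \<Rightarrow> 'a \<Rightarrow> ('a \<times> 'a) set set" where
  "orbit_points q n \<omega> y = {proj_point q (1, \<omega> ^ i * y) | i. i \<le> q ^ n}"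

end

theory Submission
  imports Defs "HOL-Computational_Algebra.Polynomial" "HOL-Computational_Algebra.Euclidean_Algorithm"
begin

text \<open>Put \<open>b = y\<^sup>N\<close> with \<open>N = q\<^sup>n + 1\<close>, so that \<open>Tr b = 1\<close>. Two points of \<open>S\<^sub>y\<close> are perpendicular iff
  \<open>Tr (x b) = 1\<close> for the quotient \<open>x\<close> of their parameters, hence an ovoid requires that no \<open>x \<noteq> 1\<close>
  with \<open>x\<^sup>N = 1\<close> satisfies \<open>Tr (x b) = 1\<close>.

  If there is no such \<open>x\<close>, then on the \<open>N\<close>-th roots of unity the polynomial
  \<open>(1 - Tr (X b))\<close> to the power \<open>q\<^sup>2 - 1 = (q - 1) + q (q - 1)\<close> is one minus the indicator of 1, so every
  nonzero residue modulo \<open>N\<close> occurs among its exponents. These are sums of at most \<open>2 (q - 1)\<close> powers of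
  \<open>q\<close>, that is, sums \<open>\<Sum>i<n. d\<^sub>i (-q)\<^sup>i\<close> with \<open>\<Sum>i<n. \<bar>d\<^sub>i\<bar> \<le> 2 (q - 1)\<close>. For \<open>n \<ge> 5\<close> the residue all of whose
  digits are \<open>q div 2\<close> is not of this form.

  For \<open>n = 3\<close> a Cayley parametrisation of the \<open>x \<noteq> 1\<close> turns \<open>Tr (x b) = 1\<close> into a linear and a quadratic
  equation over the field of order \<open>q\<close>, and these have a common solution whenever \<open>b \<noteq> 1\<close>. If \<open>b = 1\<close>, then
  \<open>3 = Tr 1 = 1\<close>, so \<open>q\<close> is even, and \<open>y\<close> is an \<open>N\<close>-th root of unity.

  Conversely let \<open>n = 3\<close> and \<open>q\<close> be even. If \<open>x\<close> has norm and trace 1, then so has the inverse of \<open>x\<close>, whence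
  \<open>(1 - x) (1 - x') (1 - x'') = 0\<close> for the conjugates. That every maximal totally singular subspace meets \<open>S\<^sub>1\<close>
  follows by taking square roots.\<close>

section \<open>Digit sums in base \<open>-q\<close>\<close>

text \<open>A potential for the carry: in \<open>digit_sum_bound\<close> below each digit contributes at least \<open>(q - 1) / 2\<close> up to
  half the change of the potential of the carry, and the changes telescope.\<close>

definition digit_potential :: "int \<Rightarrow> int \<Rightarrow> int" where
  "digit_potential q k = (if odd q then 2 * \<bar>k\<bar> else if k \<ge> 0 then 2 * k else - 2 * k - 1)"

text \<open>The absolute value is bounded below by plus or minus its argument, according to the sign
  of \<open>k\<close>. For even \<open>q\<close> the doubled digit is \<open>q\<close> instead of
  \<open>q - 1\<close>; the lower potential of negative \<open>k\<close> absorbs this.\<close>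

lemma digit_potential_step:
  fixes q k l :: int
  assumes "q \<ge> 2"
  shows "q - 1 + digit_potential q k - digit_potential q l \<le> 2 * \<bar>q div 2 + (l + q * k)\<bar>"
proof -
  define t m where "t = q * k" and "m = q div 2"
  have m: "2 * m = (if odd q then q - 1 else q)"
    unfolding m_def by (auto elim!: evenE oddE)
  have t: "if k \<ge> 0 then 2 * k \<le> t else t \<le> - q + 2 * (k + 1)"
  proof (cases "k \<ge> 0")
    case True
    then have "2 * k \<le> q * k"
      using assms by (intro mult_right_mono) auto
    with True show ?thesis
      by (simp add: t_def)
  next
    case False
    then have "2 * (- 1 - k) \<le> q * (- 1 - k)"
      using assms by (intro mult_right_mono) auto
    with False show ?thesis
      by (simp add: t_def algebra_simps)
  qed
  have "q - 1 + digit_potential q k - digit_potential q l \<le> 2 * \<bar>m + (l + t)\<bar>"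
    using m t assms abs_ge_self[of "m + (l + t)"] abs_ge_minus_self[of "m + (l + t)"]
    unfolding digit_potential_def by (auto split: if_splits)
  then show ?thesis
    by (simp only: m_def t_def)
qed

lemma digit_sum_bound:
  fixes q K L :: int and c :: "nat \<Rightarrow> int"
  assumes "q \<ge> 2" and "(\<Sum>i<n. c i * (- q) ^ i) = K - L * (- q) ^ n"
  shows "int n * (q - 1) + digit_potential q L - digit_potential q K
    \<le> 2 * (\<Sum>i<n. \<bar>q div 2 + c i\<bar>)"
  using assms(2)
proof (induction n arbitrary: c K)
  case (Suc n)
  define S where "S = (\<Sum>i<n. c (Suc i) * (- q) ^ i)"
  have "(\<Sum>i<Suc n. c i * (- q) ^ i) = c 0 - q * S"
    unfolding S_def sum.lessThan_Suc_shift
    by (simp add: sum_distrib_left sum_negf mult_ac)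
  then have S: "c 0 = K + q * (S + L * (- q) ^ n)"
    using Suc.prems by (simp add: algebra_simps)
  \<comment> \<open>The carry out of the lowest digit; it takes the place of \<open>K\<close> for
    the shifted digits.\<close>
  let ?k = "S + L * (- q) ^ n"
  have "(\<Sum>i<n. c (Suc i) * (- q) ^ i) = ?k - L * (- q) ^ n"
    by (simp add: S_def)
  from Suc.IH[OF this]
  have "int n * (q - 1) + digit_potential q L - digit_potential q ?k
      \<le> 2 * (\<Sum>i<n. \<bar>q div 2 + c (Suc i)\<bar>)" .
  moreover have "q - 1 + digit_potential q ?k - digit_potential q K \<le> 2 * \<bar>q div 2 + c 0\<bar>"
    using digit_potential_step[OF assms(1), of ?k K] S by simp
  ultimately show ?case
    unfolding sum.lessThan_Suc_shift by (simp add: algebra_simps)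
qed simp

text \<open>As \<open>n\<close> is odd, \<open>q ^ n + 1 = 1 - (- q) ^ n\<close>, so the carry
  \<open>K\<close> that enters also leaves and the potentials cancel. What remains is a lower bound
  \<open>n * (q - 1) / 2\<close>, which exceeds \<open>2 * (q - 1)\<close> for
  \<open>n \<ge> 5\<close>.\<close>

lemma digit_sum_gt:
  fixes d :: "nat \<Rightarrow> int"
  assumes "q \<ge> 2" and "odd n" and "n \<ge> 5"
    and "q ^ n + 1 dvd (\<Sum>i<n. (d i - q div 2) * (- q) ^ i)"
  shows "2 * (q - 1) < (\<Sum>i<n. \<bar>d i\<bar>)"
proof -
  obtain K where "(\<Sum>i<n. (d i - q div 2) * (- q) ^ i) = (q ^ n + 1) * K"
    using assms(4) by (elim dvdE)
  then have "(\<Sum>i<n. (d i - q div 2) * (- q) ^ i) = K - K * (- q) ^ n"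
    using \<open>odd n\<close> by (simp add: algebra_simps)
  from digit_sum_bound[OF assms(1) this]
  have "int n * (q - 1) \<le> 2 * (\<Sum>i<n. \<bar>d i\<bar>)"
    by simp
  moreover have "5 * (q - 1) \<le> int n * (q - 1)"
    using assms by (intro mult_right_mono) auto
  ultimately have "5 * (q - 1) \<le> 2 * (\<Sum>i<n. \<bar>d i\<bar>)"
    by (rule order_trans[rotated])
  with assms(1) show ?thesis
    by simp
qed

section \<open>The finite field\<close>

lemma finite_field_power_CARD:
  fixes x :: "'a :: {field, finite}"
  shows "x ^ CARD('a) = x"
proof (cases "x = 0")
  case False
  define P where "P = (\<Prod>y\<in>UNIV - {0::'a}. y)"
  have "P = (\<Prod>y\<in>UNIV - {0}. x * y)"
    unfolding P_def
    by (rule prod.reindex_bij_witness[of _ "\<lambda>y. x * y" "\<lambda>y. y / x"]) (use False in auto)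
  also have "\<dots> = x ^ (CARD('a) - 1) * P"
    by (simp add: prod.distrib P_def card_Diff_singleton)
  finally have "x ^ (CARD('a) - 1) = 1"
    by (simp add: P_def)
  then show ?thesis
    by (metis mult.right_neutral power_eq_if zero_less_card_finite less_numeral_extra(3))
qed simp

lemma of_nat_CARD_eq_0: "of_nat CARD('a :: {ring_1, finite}) = (0 :: 'a)"
proof -
  have "(\<Sum>y\<in>UNIV. y :: 'a) = (\<Sum>y\<in>UNIV. y + 1)"
    by (rule sum.reindex_bij_witness[of _ "\<lambda>y. y + 1" "\<lambda>y. y - 1"]) auto
  then show ?thesis
    by (simp add: sum.distrib)
qed

lemma CHAR_eq_of_CARD_prime_power:
  assumes "prime p" and "CARD('a :: {field, finite}) = p ^ k"
  shows "CHAR('a) = p"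
proof -
  have dvd: "CHAR('a) dvd p ^ k"
    using of_nat_CARD_eq_0[where 'a = 'a] assms(2) of_nat_eq_0_iff_char_dvd by metis
  have "CHAR('a) > 0"
    using dvd assms(1) by (metis dvd_0_left_iff gr0I power_not_zero prime_gt_0_nat less_numeral_extra(3))
  then have "prime CHAR('a)"
    by (rule prime_CHAR_semidom)
  with dvd assms(1) show ?thesis
    by (metis prime_dvd_power primes_dvd_imp_eq)
qed

locale singer_setting =
  fixes p d q n :: nat and \<omega> :: "'a::{field,finite}"
  assumes prime_p: "prime p" and d_ge: "d \<ge> 1" and q_def: "q = p ^ d"
    and n_ge: "n \<ge> 3" and odd_n: "odd n"
    and card_field: "CARD('a) = q ^ (2 * n)"
    and order_omega: "has_mult_order \<omega> (q ^ n + 1)"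
begin

lemma q_ge_2: "q \<ge> 2"
  unfolding q_def using prime_ge_2_nat[OF prime_p] d_ge self_le_power[of p d] by linarith

lemma CHAR_eq: "CHAR('a) = p"
  by (rule CHAR_eq_of_CARD_prime_power[OF prime_p, of "d * (2 * n)"])
    (simp add: card_field q_def power_mult)

lemma of_nat_q [simp]: "of_nat q = (0 :: 'a)"
  using d_ge by (simp add: q_def of_nat_eq_0_iff_char_dvd CHAR_eq)

lemma frob_add: "(x + y :: 'a) ^ (q ^ k) = x ^ (q ^ k) + y ^ (q ^ k)"
  by (rule freshmans_dream'[of _ "d * k"]) (simp_all add: CHAR_eq prime_p q_def power_mult)

lemma frob_sum: "(\<Sum>i\<in>A. f i :: 'a) ^ (q ^ k) = (\<Sum>i\<in>A. f i ^ (q ^ k))"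
  by (rule freshmans_dream_sum'[of _ "d * k"]) (simp_all add: CHAR_eq prime_p q_def power_mult)

lemma frob_diff: "(x - y :: 'a) ^ (q ^ k) = x ^ (q ^ k) - y ^ (q ^ k)"
  using frob_add[of "x - y" y k] by simp

lemma frob_full: "(x :: 'a) ^ (q ^ (2 * n)) = x"
  using finite_field_power_CARD[of x] by (simp add: card_field)

lemma omega_power: "\<omega> ^ (q ^ n + 1) = 1" and omega_nz: "\<omega> \<noteq> 0"
  using order_omega by (auto simp: has_mult_order_def)

lemma omega_power_eq_1_iff: "\<omega> ^ m = 1 \<longleftrightarrow> q ^ n + 1 dvd m"
proof
  assume "\<omega> ^ m = 1"
  have "\<omega> ^ m = (\<omega> ^ (q ^ n + 1)) ^ (m div (q ^ n + 1)) * \<omega> ^ (m mod (q ^ n + 1))"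
    by (simp only: power_mult[symmetric] power_add[symmetric] mult_div_mod_eq)
  then have "\<omega> ^ (m mod (q ^ n + 1)) = 1"
    using \<open>\<omega> ^ m = 1\<close> omega_power by simp
  moreover have "m mod (q ^ n + 1) < q ^ n + 1"
    by (rule mod_less_divisor) simp
  moreover have "\<forall>m. 0 < m \<and> m < q ^ n + 1 \<longrightarrow> \<omega> ^ m \<noteq> 1"
    using order_omega unfolding has_mult_order_def by (elim conjE)
  ultimately have "m mod (q ^ n + 1) = 0"
    by (meson gr0I)
  then show "q ^ n + 1 dvd m"
    by (simp only: mod_eq_0_iff_dvd)
next
  assume "q ^ n + 1 dvd m"
  then obtain k where "m = (q ^ n + 1) * k"
    by (elim dvdE)
  then show "\<omega> ^ m = 1"
    by (simp only: power_mult omega_power power_one)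
qed

lemma inj_omega_power: "inj_on (\<lambda>i. \<omega> ^ i) {..<q ^ n + 1}"
proof (rule linorder_inj_onI)
  fix i j assume ij: "i < j" "j \<in> {..<q ^ n + 1}"
  show "\<omega> ^ i \<noteq> \<omega> ^ j"
  proof
    assume "\<omega> ^ i = \<omega> ^ j"
    moreover have "\<omega> ^ j = \<omega> ^ i * \<omega> ^ (j - i)"
      unfolding power_add[symmetric] using ij(1) by simp
    ultimately have "\<omega> ^ (j - i) = 1"
      using omega_nz by simp
    then have "q ^ n + 1 dvd j - i"
      by (simp only: omega_power_eq_1_iff)
    then have "q ^ n + 1 \<le> j - i"
      using ij by (intro dvd_imp_le) simp_all
    then show False
      using ij by simp
  qed
qed (rule linear)

text \<open>The distinct powers of \<open>\<omega>\<close> already exhaust the roots that a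
  polynomial of degree \<open>q ^ n + 1\<close> can have.\<close>

lemma root_of_unity_eq_omega_power:
  assumes "x ^ (q ^ n + 1) = (1 :: 'a)"
  obtains i where "i \<le> q ^ n" and "x = \<omega> ^ i"
proof -
  let ?P = "monom 1 (q ^ n + 1) - 1 :: 'a poly"
  have "coeff ?P 0 = - 1"
    by simp
  then have "?P \<noteq> 0"
    by (metis coeff_0 neg_equal_0_iff_equal zero_neq_one)
  moreover have "degree ?P \<le> q ^ n + 1"
    by (rule degree_diff_le[OF degree_monom_le]) simp
  ultimately have "card {x. poly ?P x = 0} \<le> q ^ n + 1"
    using card_poly_roots_bound le_trans by blast
  moreover have "{x. poly ?P x = 0} = {x. x ^ (q ^ n + 1) = 1}"
    by (simp add: poly_monom)
  ultimately have le: "card {x :: 'a. x ^ (q ^ n + 1) = 1} \<le> q ^ n + 1"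
    by simp
  have "(\<lambda>i. \<omega> ^ i) ` {..<q ^ n + 1} = {x. x ^ (q ^ n + 1) = 1}"
  proof (rule card_seteq)
    show "(\<lambda>i. \<omega> ^ i) ` {..<q ^ n + 1} \<subseteq> {x. x ^ (q ^ n + 1) = 1}"
    proof safe
      fix i
      show "(\<omega> ^ i) ^ (q ^ n + 1) = 1"
        by (simp only: power_mult[symmetric] mult.commute[of i]) (simp only: power_mult omega_power power_one)
    qed
    show "card {x :: 'a. x ^ (q ^ n + 1) = 1} \<le> card ((\<lambda>i. \<omega> ^ i) ` {..<q ^ n + 1})"
      using le by (simp only: card_image[OF inj_omega_power] card_lessThan)
  qed simp
  then have "x \<in> (\<lambda>i. \<omega> ^ i) ` {..<q ^ n + 1}"
    using assms by blast
  then obtain i where "i < q ^ n + 1" "x = \<omega> ^ i"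
    by blast
  then show ?thesis
    by (intro that[of i]) simp_all
qed

end

lemma sum_lessThan_add:
  fixes f :: "nat \<Rightarrow> 'b::comm_monoid_add"
  shows "(\<Sum>i<m + n. f i) = (\<Sum>i<m. f i) + (\<Sum>i<n. f (m + i))"
  by (induction n) (simp_all add: add_ac)

section \<open>Power sums over the roots of unity\<close>

text \<open>Digits may exceed \<open>q - 1\<close>: the elements are the unreduced exponents of
  products of at most \<open>w\<close> factors \<open>x ^ (q ^ i)\<close>.\<close>

definition digit_sums :: "nat \<Rightarrow> nat \<Rightarrow> nat \<Rightarrow> nat set" where
  "digit_sums q m w = {\<Sum>i<m. a i * q ^ i | a. (\<Sum>i<m. a i) \<le> w}"

lemma zero_in_digit_sums: "0 \<in> digit_sums q m w"
  unfolding digit_sums_def by (auto intro!: exI[of _ "\<lambda>_. 0"])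

lemma digit_sums_mono: "v \<le> w \<Longrightarrow> digit_sums q m v \<subseteq> digit_sums q m w"
  unfolding digit_sums_def by (blast intro: order_trans)

lemma add_power_in_digit_sums:
  assumes "e \<in> digit_sums q m w" and "l < m"
  shows "e + q ^ l \<in> digit_sums q m (Suc w)"
proof -
  obtain a where a: "e = (\<Sum>i<m. a i * q ^ i)" "(\<Sum>i<m. a i) \<le> w"
    using assms(1) by (auto simp: digit_sums_def)
  define a' where "a' i = a i + (if i = l then 1 else 0)" for i
  have "(\<Sum>i<m. a' i) \<le> Suc w"
    using a(2) assms(2) by (simp add: a'_def sum.distrib)
  moreover have "a' i * q ^ i = a i * q ^ i + (if i = l then q ^ l else 0)" for i
    by (simp add: a'_def algebra_simps)
  then have "(\<Sum>i<m. a' i * q ^ i) = e + q ^ l"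
    using a(1) assms(2) by (simp add: sum.distrib)
  ultimately show ?thesis
    unfolding digit_sums_def by (metis (mono_tags, lifting) mem_Collect_eq)
qed

text \<open>Since \<open>q ^ n\<close> is \<open>- 1\<close> modulo \<open>q ^ n + 1\<close>, the
  \<open>2 * n\<close> digits of \<open>e\<close> fold into \<open>n\<close> signed digits
  \<open>d i\<close> in base \<open>- q\<close> without increasing the total weight. Then
  \<open>digit_sum_gt\<close> keeps \<open>e\<close> away from the residue \<open>M\<close>.\<close>

lemma exists_avoiding_digit_sums:
  assumes "q \<ge> 2" and "odd n" and "n \<ge> 5"
  obtains J where "\<And>e. e \<in> digit_sums q (2 * n) (2 * (q - 1)) \<Longrightarrow> \<not> q ^ n + 1 dvd e + J"
proof -
  define N M :: int where "N = int q ^ n + 1" and "M = (\<Sum>i<n. (int q div 2) * (- int q) ^ i)"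
  \<comment> \<open>\<open>J\<close> represents \<open>- M\<close>, so divisibility of
    \<open>e + J\<close> means that \<open>e\<close> is congruent to \<open>M\<close>.\<close>
  define J where "J = nat ((- M) mod N)"
  have "N > 0"
    by (simp add: N_def add_nonneg_pos)
  have False if e: "e \<in> digit_sums q (2 * n) (2 * (q - 1))" and dvd: "q ^ n + 1 dvd e + J" for e
  proof -
    obtain a where a: "e = (\<Sum>i<2 * n. a i * q ^ i)" "(\<Sum>i<2 * n. a i) \<le> 2 * (q - 1)"
      using e by (auto simp: digit_sums_def)
    define d :: "nat \<Rightarrow> int" where "d i = (- 1) ^ i * (int (a i) - int (a (n + i)))" for i
    have "int (q ^ n + 1) dvd int (e + J)"
      using dvd by (simp only: of_nat_dvd_iff)
    then have "N dvd int e + int J"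
      by (simp add: N_def add_ac)
    moreover have "N dvd - M - int J"
      using \<open>N > 0\<close> by (simp add: J_def minus_mod_eq_mult_div)
    ultimately have "N dvd int e - M"
      using dvd_add[of N "int e + int J" "- M - int J"] by simp
    have "int e = (\<Sum>i<n. int (a i) * int q ^ i) + (\<Sum>i<n. int (a (n + i)) * int q ^ (n + i))"
      by (simp add: a(1) mult_2 sum_lessThan_add)
    also have "\<dots> = (\<Sum>i<n. d i * (- int q) ^ i) + N * (\<Sum>i<n. int (a (n + i)) * int q ^ i)"
      unfolding sum_distrib_left sum.distrib[symmetric]
    proof (rule sum.cong[OF refl])
      fix i
      have "d i * (- int q) ^ i = (int (a i) - int (a (n + i))) * (((- 1) ^ i * (- 1) ^ i) * int q ^ i)"
        unfolding d_def power_minus[of "int q"] by (simp only: mult_ac)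
      also have "\<dots> = (int (a i) - int (a (n + i))) * int q ^ i"
        by (simp flip: power_add)
      finally show "int (a i) * int q ^ i + int (a (n + i)) * int q ^ (n + i) =
          d i * (- int q) ^ i + N * (int (a (n + i)) * int q ^ i)"
        by (simp add: N_def power_add algebra_simps)
    qed
    finally have "int e - M = (\<Sum>i<n. (d i - int q div 2) * (- int q) ^ i)
        + N * (\<Sum>i<n. int (a (n + i)) * int q ^ i)"
      by (simp add: M_def sum_subtractf left_diff_distrib)
    with \<open>N dvd int e - M\<close> have "N dvd (\<Sum>i<n. (d i - int q div 2) * (- int q) ^ i)"
      by (simp add: dvd_add_left_iff)
    then have "2 * (int q - 1) < (\<Sum>i<n. \<bar>d i\<bar>)"
      using assms by (intro digit_sum_gt) (simp_all add: N_def)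
    also have "\<dots> \<le> (\<Sum>i<n. int (a i) + int (a (n + i)))"
      by (intro sum_mono) (simp add: d_def abs_mult)
    also have "\<dots> = int (\<Sum>i<2 * n. a i)"
      by (simp add: mult_2 sum_lessThan_add sum.distrib)
    also have "\<dots> \<le> 2 * (int q - 1)"
    proof -
      have "int (\<Sum>i<2 * n. a i) \<le> int (2 * (q - 1))"
        using a(2) by (simp only: of_nat_le_iff)
      also have "\<dots> = 2 * (int q - 1)"
        using assms(1) by simp
      finally show ?thesis .
    qed
    finally show False
      by simp
  qed
  then show ?thesis
    using that by blast
qed

lemma trace_Fq2_0 [simp]: "q > 0 \<Longrightarrow> trace_Fq2 q n 0 = 0"
  by (simp add: trace_Fq2_def power_0_left)

section \<open>The trace to the field of order \<open>q ^ 2\<close> and functions of low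
  weight\<close>

context singer_setting
begin

lemma n_pos: "n > 0"
  using n_ge by simp

lemma q_pos: "q > 0"
  using q_ge_2 by simp

lemma omega_power_root: "(\<omega> ^ i) ^ (q ^ n + 1) = 1"
  by (simp only: power_mult[symmetric] mult.commute[of i]) (simp only: power_mult omega_power power_one)

lemma trace_add: "trace_Fq2 q n (x + y :: 'a) = trace_Fq2 q n x + trace_Fq2 q n y"
  by (simp add: trace_Fq2_def frob_add sum.distrib)

lemma trace_diff: "trace_Fq2 q n (x - y :: 'a) = trace_Fq2 q n x - trace_Fq2 q n y"
  by (simp add: trace_Fq2_def frob_diff sum_subtractf)

lemma Fq2_power: "a ^ (q ^ (2 * i)) = a" if "a \<in> Fq2 q" for a :: 'a
proof (induction i)
  case (Suc i)
  have "a ^ (q ^ (2 * Suc i)) = (a ^ (q ^ (2 * i))) ^ (q ^ 2)"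
    by (simp add: power_add power2_eq_square mult_ac flip: power_mult)
  with Suc that show ?case
    by (simp add: Fq2_def)
qed simp

lemma trace_scale: "a \<in> Fq2 q \<Longrightarrow> trace_Fq2 q n (a * x :: 'a) = a * trace_Fq2 q n x"
  by (simp add: trace_Fq2_def power_mult_distrib Fq2_power sum_distrib_left)

lemma power_q_power_q: "((x :: 'a) ^ (q ^ i)) ^ (q ^ j) = x ^ (q ^ (i + j))"
  by (simp only: power_mult[symmetric] power_add)

lemma trace_power_q: "trace_Fq2 q n x ^ q = (\<Sum>i<n. (x :: 'a) ^ (q ^ (2 * i + 1)))"
proof -
  have "trace_Fq2 q n x ^ (q ^ 1) = (\<Sum>i<n. (x :: 'a) ^ (q ^ (2 * i + 1)))"
    by (simp only: trace_Fq2_def frob_sum power_q_power_q)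
  then show ?thesis
    by simp
qed

lemma trace_in_Fq2: "trace_Fq2 q n (x :: 'a) \<in> Fq2 q"
proof -
  obtain m where m: "n = Suc m"
    using n_pos gr0_implies_Suc by blast
  have "trace_Fq2 q n x ^ (q ^ 2) = (\<Sum>i<n. x ^ (q ^ (2 * i + 2)))"
    by (simp only: trace_Fq2_def frob_sum power_q_power_q)
  also have "\<dots> = (\<Sum>i<m. x ^ (q ^ (2 * i + 2))) + x ^ (q ^ (2 * n))"
    by (simp add: m)
  also have "\<dots> = (\<Sum>i<m. x ^ (q ^ (2 * Suc i))) + x ^ (q ^ (2 * 0))"
    by (simp only: frob_full) simp
  also have "\<dots> = trace_Fq2 q n x"
    unfolding trace_Fq2_def m by (subst sum.lessThan_Suc_shift) (simp only: add.commute)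
  finally show ?thesis
    by (simp add: Fq2_def)
qed

lemma sum_omega_power:
  "(\<Sum>i<q ^ n + 1. (\<omega> ^ i) ^ J) = (if q ^ n + 1 dvd J then 1 else 0)"
proof -
  have eq: "(\<Sum>i<q ^ n + 1. (\<omega> ^ i) ^ J) = (\<Sum>i<q ^ n + 1. (\<omega> ^ J) ^ i)"
    by (simp only: power_mult[symmetric] mult.commute)
  show ?thesis
  proof (cases "q ^ n + 1 dvd J")
    case True
    then have "\<omega> ^ J = 1"
      by (simp only: omega_power_eq_1_iff)
    \<comment> \<open>All terms are 1, and their number \<open>q ^ n + 1\<close> is 1 in the field
      because \<open>of_nat q = 0\<close>.\<close>
    with True n_pos show ?thesis
      unfolding eq by (simp add: power_0_left)
  next
    case False
    then have "\<omega> ^ J \<noteq> 1"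
      unfolding omega_power_eq_1_iff .
    moreover have "(\<omega> ^ J) ^ (q ^ n + 1) = 1"
      by (rule omega_power_root)
    ultimately show ?thesis
      using False unfolding eq geometric_sum[OF \<open>\<omega> ^ J \<noteq> 1\<close>] by (simp only: diff_self div_0 if_False)
  qed
qed

text \<open>On the group generated by \<open>\<omega>\<close> such an \<open>f\<close> behaves like a polynomial all of whose exponents lie
  in \<^term>\<open>digit_sums q (2 * n) w\<close>.\<close>

definition low_weight :: "nat \<Rightarrow> ('a \<Rightarrow> 'a) \<Rightarrow> bool" where
  "low_weight w f \<longleftrightarrow> (\<forall>J. (\<forall>e\<in>digit_sums q (2 * n) w. \<not> q ^ n + 1 dvd e + J) \<longrightarrow>
     (\<Sum>i<q ^ n + 1. (\<omega> ^ i) ^ J * f (\<omega> ^ i)) = 0)"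

lemma low_weight_1: "low_weight w (\<lambda>_. 1)"
  unfolding low_weight_def
proof (intro allI impI)
  fix J assume "\<forall>e\<in>digit_sums q (2 * n) w. \<not> q ^ n + 1 dvd e + J"
  from bspec[OF this zero_in_digit_sums] have "\<not> q ^ n + 1 dvd J"
    by (simp only: add_0 not_False_eq_True)
  then show "(\<Sum>i<q ^ n + 1. (\<omega> ^ i) ^ J * 1) = 0"
    unfolding mult_1_right sum_omega_power by (simp only: if_False)
qed

text \<open>Expanding the new factor reduces the power sum for \<open>J\<close> to those of
  \<open>f\<close> for \<open>J\<close> and \<open>q ^ e l + J\<close>. If \<open>J\<close> is
  avoided with weight \<open>Suc w\<close>, these exponents are avoided with weight
  \<open>w\<close>.\<close>

lemma low_weight_mult:
  assumes f: "low_weight w f" and e: "\<And>l. l \<in> A \<Longrightarrow> e l < 2 * n"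
  shows "low_weight (Suc w) (\<lambda>x. f x * (1 - (\<Sum>l\<in>A. c l * x ^ (q ^ e l))))"
  unfolding low_weight_def
proof (intro allI impI)
  fix J assume J: "\<forall>e\<in>digit_sums q (2 * n) (Suc w). \<not> q ^ n + 1 dvd e + J"
  let ?S = "\<lambda>J. \<Sum>i<q ^ n + 1. (\<omega> ^ i) ^ J * f (\<omega> ^ i)"
  have "\<forall>k\<in>digit_sums q (2 * n) w. \<not> q ^ n + 1 dvd k + J"
    using J digit_sums_mono[of w "Suc w" q "2 * n"] by (meson le_SucI order_refl subsetD)
  with f have S_J: "?S J = 0"
    unfolding low_weight_def by (elim allE impE)
  have S_A: "?S (q ^ e l + J) = 0" if "l \<in> A" for l
  proof -
    have "\<forall>k\<in>digit_sums q (2 * n) w. \<not> q ^ n + 1 dvd k + (q ^ e l + J)"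
    proof
      fix k assume "k \<in> digit_sums q (2 * n) w"
      from bspec[OF J add_power_in_digit_sums[OF this e[OF that]]]
      show "\<not> q ^ n + 1 dvd k + (q ^ e l + J)"
        by (simp only: add.assoc not_False_eq_True)
    qed
    with f show ?thesis
      unfolding low_weight_def by (elim allE impE)
  qed
  have "(\<omega> ^ i) ^ J * (f (\<omega> ^ i) * (1 - (\<Sum>l\<in>A. c l * (\<omega> ^ i) ^ (q ^ e l)))) =
      (\<omega> ^ i) ^ J * f (\<omega> ^ i) - (\<Sum>l\<in>A. c l * ((\<omega> ^ i) ^ (q ^ e l + J) * f (\<omega> ^ i)))" for i
    by (simp only: power_add right_diff_distrib sum_distrib_left mult_1_left mult_1_right mult_ac)
  then have "(\<Sum>i<q ^ n + 1. (\<omega> ^ i) ^ J * (f (\<omega> ^ i) * (1 - (\<Sum>l\<in>A. c l * (\<omega> ^ i) ^ (q ^ e l)))))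
      = ?S J - (\<Sum>i<q ^ n + 1. \<Sum>l\<in>A. c l * ((\<omega> ^ i) ^ (q ^ e l + J) * f (\<omega> ^ i)))"
    by (simp only: sum_subtractf)
  also have "\<dots> = ?S J - (\<Sum>l\<in>A. c l * ?S (q ^ e l + J))"
    unfolding sum_distrib_left by (subst sum.swap) (rule refl)
  also have "(\<Sum>l\<in>A. c l * ?S (q ^ e l + J)) = 0"
  proof (rule sum.neutral, rule ballI)
    fix l assume "l \<in> A"
    then show "c l * ?S (q ^ e l + J) = 0"
      by (simp only: S_A mult_zero_right)
  qed
  finally show "(\<Sum>i<q ^ n + 1. (\<omega> ^ i) ^ J *
      (f (\<omega> ^ i) * (1 - (\<Sum>l\<in>A. c l * (\<omega> ^ i) ^ (q ^ e l))))) = 0"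
    by (simp only: S_J diff_self)
qed

lemma low_weight_mult_power:
  assumes "low_weight w f" and "\<And>l. l \<in> A \<Longrightarrow> e l < 2 * n"
  shows "low_weight (w + k) (\<lambda>x. f x * (1 - (\<Sum>l\<in>A. c l * x ^ (q ^ e l))) ^ k)"
proof (induction k)
  case (Suc k)
  from low_weight_mult[OF Suc assms(2), where c = c and A = A] show ?case
    by (simp add: mult_ac)
qed (use assms(1) in simp)

lemma ex_trace_eq_1_of_ge_5:
  assumes "n \<ge> 5" and b: "trace_Fq2 q n b = (1 :: 'a)"
  shows "\<exists>x. x ^ (q ^ n + 1) = 1 \<and> x \<noteq> 1 \<and> trace_Fq2 q n (x * b) = 1"
proof (rule ccontr)
  assume neg: "\<not> ?thesis"
  \<comment> \<open>This is \<open>u x ^ (q ^ 2 - 1)\<close>. Distributing the inner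
    \<open>q\<close>-th power over the trace keeps the weight at \<open>2 * (q - 1)\<close>; the
    leading 1 starts the chain at \<open>low_weight_1\<close>.\<close>
  define f where "f x = 1 * (1 - (\<Sum>l<n. b ^ (q ^ (2 * l)) * x ^ (q ^ (2 * l)))) ^ (q - 1)
    * (1 - (\<Sum>l<n. b ^ (q ^ (2 * l + 1)) * x ^ (q ^ (2 * l + 1)))) ^ (q - 1)" for x
  define u where "u x = 1 - trace_Fq2 q n (x * b)" for x
  have f_eq: "f x = u x ^ (q - 1) * (u x ^ q) ^ (q - 1)" for x
  proof -
    have "(\<Sum>l<n. b ^ (q ^ (2 * l)) * x ^ (q ^ (2 * l))) = trace_Fq2 q n (x * b)"
      by (simp only: trace_Fq2_def power_mult_distrib mult.commute)
    moreover have "(\<Sum>l<n. b ^ (q ^ (2 * l + 1)) * x ^ (q ^ (2 * l + 1))) = trace_Fq2 q n (x * b) ^ q"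
      by (simp only: trace_power_q power_mult_distrib mult.commute)
    moreover have "1 - trace_Fq2 q n (x * b) ^ q = u x ^ q"
      using frob_diff[of 1 "trace_Fq2 q n (x * b)" 1] by (simp add: u_def)
    ultimately show ?thesis
      by (simp only: f_def u_def mult_1_left)
  qed
  have f_1: "f 1 = 0"
    using q_ge_2 by (simp add: f_eq u_def b power_0_left)
  have f_root: "f (\<omega> ^ Suc i) = 1" if "i < q ^ n" for i
  proof -
    have "\<not> q ^ n + 1 dvd Suc i"
      using that by (intro nat_dvd_not_less) simp_all
    then have "\<omega> ^ Suc i \<noteq> 1"
      unfolding omega_power_eq_1_iff .
    with neg omega_power_root have "u (\<omega> ^ Suc i) \<noteq> 0"
      unfolding u_def by (metis eq_iff_diff_eq_0)
    moreover have "u (\<omega> ^ Suc i) ^ (q ^ 2) = u (\<omega> ^ Suc i)"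
      using trace_in_Fq2[of "\<omega> ^ Suc i * b"] unfolding u_def frob_diff by (simp add: Fq2_def)
    \<comment> \<open>One more factor \<open>u\<close> raises the exponent to \<open>q ^ 2\<close>,
      where the power is \<open>u\<close> itself; cancelling \<open>u\<close> leaves 1.\<close>
    moreover have "u (\<omega> ^ Suc i) * f (\<omega> ^ Suc i) = u (\<omega> ^ Suc i) ^ (1 + ((q - 1) + q * (q - 1)))"
      by (simp only: f_eq power_add power_mult power_one_right)
    moreover have "1 + ((q - 1) + q * (q - 1)) = q ^ 2"
      using q_pos by (simp add: power2_eq_square diff_mult_distrib2)
    ultimately show ?thesis
      by (metis mult_cancel_left1)
  qed
  have "low_weight (0 + (q - 1) + (q - 1)) f"
    unfolding f_def by (intro low_weight_mult_power low_weight_1) auto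
  then have low: "low_weight (2 * (q - 1)) f"
    by (simp only: add_0 mult_2)
  obtain J where J: "\<And>e. e \<in> digit_sums q (2 * n) (2 * (q - 1)) \<Longrightarrow> \<not> q ^ n + 1 dvd e + J"
    using exists_avoiding_digit_sums[OF q_ge_2 odd_n assms(1)] by blast
  have "\<not> q ^ n + 1 dvd J"
    using J[OF zero_in_digit_sums] by (simp only: add_0 not_False_eq_True)
  then have "(\<Sum>i<q ^ n + 1. (\<omega> ^ i) ^ J) = 0"
    by (simp only: sum_omega_power if_False)
  \<comment> \<open>This sum and the preceding one both vanish, yet they differ exactly in the term
    \<open>i = 0\<close>, where \<open>f\<close> is 0 instead of 1.\<close>
  moreover have "(\<Sum>i<q ^ n + 1. (\<omega> ^ i) ^ J * f (\<omega> ^ i)) = 0"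
    using low J unfolding low_weight_def by blast
  moreover have "(\<Sum>i<q ^ n + 1. (\<omega> ^ i) ^ J) = 1 + (\<Sum>i<q ^ n. (\<omega> ^ Suc i) ^ J)"
    unfolding Suc_eq_plus1[symmetric] sum.lessThan_Suc_shift by simp
  moreover have "(\<Sum>i<q ^ n + 1. (\<omega> ^ i) ^ J * f (\<omega> ^ i)) = (\<Sum>i<q ^ n. (\<omega> ^ Suc i) ^ J)"
    unfolding Suc_eq_plus1[symmetric] sum.lessThan_Suc_shift
    using f_root by (simp add: f_1 del: power_Suc)
  ultimately show False
    by simp
qed

end

section \<open>Dimension three\<close>

text \<open>Writing each quotient as \<open>1 + (c - z) / (r + z)\<close> leaves a sum of fractions
  with numerators \<open>b0\<close>, \<open>b1\<close>, \<open>b2\<close>. Cleared of denominators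
  it is \<open>z * c - z * (z + c) + z ^ 2\<close>.\<close>

lemma sum_Moebius_eq_1:
  fixes z c r0 r1 r2 b0 b1 b2 :: "'b::field"
  assumes b: "b0 + b1 + b2 = 1"
    and lin: "(1 - b0) * r0 + (1 - b1) * r1 + (1 - b2) * r2 = - (z + c)"
    and quad: "b0 * r1 * r2 + b1 * r2 * r0 + b2 * r0 * r1 = z * c"
    and nz: "r0 + z \<noteq> 0" "r1 + z \<noteq> 0" "r2 + z \<noteq> 0"
  shows "(r0 + c) / (r0 + z) * b0 + (r1 + c) / (r1 + z) * b1 + (r2 + c) / (r2 + z) * b2 = 1"
proof -
  have *: "(r + c) / (r + z) = 1 + (c - z) / (r + z)" if "r + z \<noteq> 0" for r
    using that by (simp add: field_simps)
  have "b0 * (r1 + z) * (r2 + z) + b1 * (r0 + z) * (r2 + z) + b2 * (r0 + z) * (r1 + z) = 0"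
    using b lin quad by algebra
  then have "b0 / (r0 + z) + b1 / (r1 + z) + b2 / (r2 + z) = 0"
    using nz by (simp add: divide_simps) (simp add: algebra_simps)
  then have "(c - z) * (b0 / (r0 + z) + b1 / (r1 + z) + b2 / (r2 + z)) = 0"
    by simp
  then show ?thesis
    using b unfolding *[OF nz(1)] *[OF nz(2)] *[OF nz(3)]
    by (simp add: algebra_simps)
qed

text \<open>Squaring is at most two-to-one and 0 has a single root, so the squares fill more than
  half of \<open>K\<close>.\<close>

lemma card_squares_ge:
  fixes K :: "'b::idom set"
  assumes "finite K" and "0 \<in> K"
  shows "card K + 1 \<le> 2 * card ((\<lambda>x. x ^ 2) ` K)"
proof -
  let ?sq = "\<lambda>x::'b. x ^ 2"
  have "card (K - {0}) \<le> card (\<Union>y\<in>?sq ` (K - {0}). {x. ?sq x = y} \<inter> K)"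
    using assms(1) by (intro card_mono) auto
  also have "\<dots> \<le> (\<Sum>y\<in>?sq ` (K - {0}). card ({x. ?sq x = y} \<inter> K))"
    using assms(1) by (intro card_UN_le) simp
  also have "\<dots> \<le> (\<Sum>y\<in>?sq ` (K - {0}). 2)"
  proof (rule sum_mono)
    fix y assume "y \<in> ?sq ` (K - {0})"
    then obtain s where s: "y = s ^ 2"
      by blast
    have "{x. ?sq x = y} \<inter> K \<subseteq> {s, - s}"
      by (auto simp: s power2_eq_iff)
    then have "card ({x. ?sq x = y} \<inter> K) \<le> card {s, - s}"
      by (intro card_mono) auto
    also have "\<dots> \<le> 2"
      by (simp add: card_insert_le_m1)
    finally show "card ({x. ?sq x = y} \<inter> K) \<le> 2" .
  qed
  finally have "card (K - {0}) \<le> 2 * card (?sq ` (K - {0}))"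
    by simp
  moreover have "?sq ` K = insert 0 (?sq ` (K - {0}))"
    using assms(2) by (auto simp: image_iff)
  moreover have "0 \<notin> ?sq ` (K - {0})"
    by auto
  moreover have "card K = Suc (card (K - {0}))"
    using assms by (metis card.remove)
  ultimately show ?thesis
    using assms(1) by simp
qed

text \<open>Pigeonhole: the values of \<open>\<alpha> * x ^ 2\<close> and of
  \<open>\<nu> - \<beta> * y ^ 2\<close> each fill more than half of \<open>K\<close>.\<close>

lemma binary_diagonal_form_universal:
  fixes K :: "'b::idom set"
  assumes K: "finite K" "0 \<in> K" "\<And>x y. x \<in> K \<Longrightarrow> y \<in> K \<Longrightarrow> x * y \<in> K"
      "\<And>x y. x \<in> K \<Longrightarrow> y \<in> K \<Longrightarrow> x - y \<in> K"
    and "\<alpha> \<in> K" "\<beta> \<in> K" "\<nu> \<in> K" "\<alpha> \<noteq> 0" "\<beta> \<noteq> 0"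
  obtains x y where "x \<in> K" "y \<in> K" "\<alpha> * x ^ 2 + \<beta> * y ^ 2 = \<nu>"
proof -
  let ?S = "(\<lambda>x. x ^ 2) ` K"
  let ?A = "(\<lambda>s. \<alpha> * s) ` ?S" and ?B = "(\<lambda>s. \<nu> - \<beta> * s) ` ?S"
  have "?A \<union> ?B \<subseteq> K"
    using assms by (auto simp: power2_eq_square)
  then have "card (?A \<union> ?B) \<le> card K"
    using K(1) by (rule card_mono[rotated])
  moreover have "card ?A = card ?S" "card ?B = card ?S"
    using assms by (auto intro!: card_image inj_onI)
  moreover have "card K + 1 \<le> 2 * card ?S"
    by (rule card_squares_ge[OF K(1,2)])
  ultimately have "?A \<inter> ?B \<noteq> {}"
    using card_Un_disjoint[of ?A ?B] K(1) by auto
  then obtain x y where "x \<in> K" "y \<in> K" "\<alpha> * x ^ 2 = \<nu> - \<beta> * y ^ 2"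
    by auto
  then show ?thesis
    by (intro that[of x y]) (auto simp: algebra_simps)
qed

section \<open>Additive polynomials and square roots\<close>

context singer_setting
begin

text \<open>Linear independence of the Frobenius powers: a nonzero polynomial of degree at most
  \<open>q ^ (m - 1)\<close> cannot vanish on the whole field.\<close>

lemma additive_poly_eq_0:
  assumes "m \<le> 2 * n" and zero: "\<And>x. (\<Sum>i<m. a i * x ^ (q ^ i)) = (0 :: 'a)" and "i < m"
  shows "a i = 0"
proof -
  define P where "P = (\<Sum>i<m. monom (a i) (q ^ i))"
  have "degree P \<le> q ^ (m - 1)"
    unfolding P_def
  proof (rule degree_sum_le)
    fix j assume "j \<in> {..<m}"
    then have "q ^ j \<le> q ^ (m - 1)"
      using q_ge_2 by (intro power_increasing) auto
    then show "degree (monom (a j) (q ^ j)) \<le> q ^ (m - 1)"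
      using degree_monom_le le_trans by blast
  qed simp
  also have "\<dots> < q ^ (2 * n)"
    using q_ge_2 assms(1,3) by (intro power_strict_increasing) auto
  also have "\<dots> = card {x. poly P x = 0}"
    using zero card_field by (simp add: P_def poly_sum poly_monom)
  finally have "P = 0"
    using card_poly_roots_bound[of P] by (meson not_le)
  then have "0 = coeff P (q ^ i)"
    by simp
  also have "\<dots> = (\<Sum>j<m. if j = i then a i else 0)"
    unfolding P_def coeff_sum coeff_monom
    using q_ge_2 by (intro sum.cong) auto
  also have "\<dots> = a i"
    using assms(3) by simp
  finally show ?thesis
    by simp
qed

lemma two_eq_0: "even q \<Longrightarrow> (2 :: 'a) = 0"
proof -
  assume "even q"
  then have "2 dvd p"
    by (simp add: q_def)
  then have "p = 2"
    using prime_p primes_dvd_imp_eq two_is_prime_nat by blast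
  then show ?thesis
    using of_nat_CHAR[where 'a = 'a] by (simp add: CHAR_eq)
qed

lemma two_neq_0: "odd q \<Longrightarrow> (2 :: 'a) \<noteq> 0"
proof
  assume "odd q" "(2 :: 'a) = 0"
  then have "p dvd 2"
    using of_nat_eq_0_iff_char_dvd[of 2, where 'a = 'a] by (simp add: CHAR_eq)
  then have "p = 2"
    using prime_p by (simp add: primes_dvd_imp_eq)
  with \<open>odd q\<close> d_ge show False
    by (simp add: q_def)
qed

lemma sqrt_unique:
  assumes "even q" and "(x :: 'a) ^ 2 = y ^ 2"
  shows "x = y"
proof -
  have "(x - y) ^ 2 = x ^ 2 - y ^ 2 + 2 * (y ^ 2 - x * y)"
    by (simp add: power2_eq_square algebra_simps)
  then show ?thesis
    using assms two_eq_0 by simp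
qed

lemma sqrt_ex:
  assumes "even q"
  shows "\<exists>y. y ^ 2 = (x :: 'a)"
proof -
  have "inj (\<lambda>y :: 'a. y ^ 2)"
    using sqrt_unique[OF assms] by (auto intro: injI)
  then have "surj (\<lambda>y :: 'a. y ^ 2)"
    by (rule finite_UNIV_inj_surj[rotated]) simp
  then show ?thesis
    by (metis surjD)
qed

end

section \<open>Frobenius calculus in the field of order \<open>q ^ 6\<close>\<close>

locale singer_cubic = singer_setting +
  assumes n_eq: "n = 3"
begin

text \<open>One, two and three applications of \<open>fr\<close> have the fields of order
  \<open>q\<close>, \<open>q ^ 2\<close> and \<open>q ^ 3\<close> as fixed fields, and three
  applications are the conjugation in \<open>herm\<close>.\<close>

definition fr :: "'a \<Rightarrow> 'a" where
  "fr x = x ^ q"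

lemma fr_simps [simp]:
  "fr 0 = 0" "fr 1 = 1" "fr (x + y) = fr x + fr y" "fr (x - y) = fr x - fr y"
  "fr (- x) = - fr x" "fr (x * y) = fr x * fr y" "fr (x / y) = fr x / fr y"
  "fr (inverse x) = inverse (fr x)" "fr (x ^ k) = fr x ^ k"
proof -
  show *: "fr (x - y) = fr x - fr y" for x y
    using frob_diff[of x y 1] by (simp add: fr_def)
  show **: "fr 0 = 0"
    using q_pos by (simp add: fr_def power_0_left)
  show "fr (- x) = - fr x"
    using *[of 0 x] by (simp add: **)
  show "fr (x + y) = fr x + fr y"
    using frob_add[of x y 1] by (simp add: fr_def)
  show "fr (x ^ k) = fr x ^ k"
    by (simp add: fr_def power_mult[symmetric] mult.commute)
qed (simp_all add: fr_def power_mult_distrib power_divide power_inverse)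

lemma fr_numeral [simp]: "fr (numeral k) = numeral k"
proof -
  have "fr (of_nat m) = of_nat m" for m
    by (induction m) simp_all
  from this[of "numeral k"] show ?thesis
    by simp
qed

lemma power_q_fr: "x ^ (q ^ k) = (fr ^^ k) x"
  by (induction k) (simp_all add: fr_def power_mult mult.commute[of q])

lemma fr6 [simp]: "fr (fr (fr (fr (fr (fr x))))) = x"
  using frob_full[of x] unfolding power_q_fr by (simp add: n_eq eval_nat_numeral)

lemma fr_eq_iff [simp]: "fr x = fr y \<longleftrightarrow> x = y"
  by (metis fr6)

lemma fr_eq_0_iff [simp]: "fr x = 0 \<longleftrightarrow> x = 0"
  by (metis fr6 fr_simps(1))

lemma fr_eq_1_iff [simp]: "fr x = 1 \<longleftrightarrow> x = 1"
  by (metis fr6 fr_simps(2))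

lemma trace_fr: "trace_Fq2 q n x = x + fr (fr x) + fr (fr (fr (fr x)))"
  by (simp add: trace_Fq2_def n_eq power_q_fr eval_nat_numeral)

lemma Fq2_fr: "x \<in> Fq2 q \<longleftrightarrow> fr (fr x) = x"
  unfolding Fq2_def power_q_fr by (simp add: eval_nat_numeral)

lemma norm_fr: "x ^ (q ^ n + 1) = x * fr (fr (fr x))"
  by (simp only: power_add power_q_fr) (simp add: n_eq eval_nat_numeral)

lemma conj_fr: "x ^ (q ^ n) = fr (fr (fr x))"
  by (simp only: power_q_fr) (simp add: n_eq eval_nat_numeral)

text \<open>The exponent is \<open>(q ^ 3 + 1) / (q + 1)\<close>, so the order is
  \<open>q + 1\<close>. This gives an element of the field of order \<open>q ^ 2\<close> outside the
  field of order \<open>q\<close>.\<close>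

definition unit_root :: 'a where
  "unit_root = \<omega> ^ (q ^ 2 - q + 1)"

lemma unit_root: "fr unit_root * unit_root = 1" "unit_root * unit_root \<noteq> 1"
  "fr (fr unit_root) = unit_root"
proof -
  have le: "q \<le> q ^ 2"
    by (simp add: power2_eq_square)
  have "int ((q ^ 2 - q + 1) * (q + 1)) = int (q ^ n + 1)"
    using le by (simp add: n_eq of_nat_diff power3_eq_cube power2_eq_square algebra_simps)
  then have N: "(q ^ 2 - q + 1) * (q + 1) = q ^ n + 1"
    by (simp only: of_nat_eq_iff)
  have "unit_root ^ (q + 1) = 1"
    unfolding unit_root_def power_mult[symmetric] N by (rule omega_power)
  then show 1: "fr unit_root * unit_root = 1"
    by (simp add: fr_def mult.commute)
  show "unit_root * unit_root \<noteq> 1"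
  proof
    assume "unit_root * unit_root = 1"
    then have "\<omega> ^ ((q ^ 2 - q + 1) * 2) = 1"
      unfolding unit_root_def by (simp only: power_mult power2_eq_square)
    then have "q ^ n + 1 dvd (q ^ 2 - q + 1) * 2"
      by (simp only: omega_power_eq_1_iff)
    then have "q + 1 dvd 2"
      unfolding N[symmetric] by (subst (asm) dvd_times_left_cancel_iff) simp_all
    then have "q + 1 \<le> 2"
      by (rule dvd_imp_le) simp
    then show False
      using q_ge_2 by simp
  qed
  have "fr (fr unit_root) * fr unit_root = 1"
    using arg_cong[OF 1, of fr] by simp
  with 1 show "fr (fr unit_root) = unit_root"
    by (metis mult.commute mult_cancel_right mult_zero_right zero_neq_one)
qed

text \<open>By Hilbert 90 every \<open>x \<noteq> 1\<close> of norm 1 is of the form \<open>(r + z\<^sup>q) / (r + z)\<close> with \<open>r\<close> in the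
  field of order \<open>q\<^sup>3\<close> and \<open>z\<close> any fixed element of the field of order \<open>q\<^sup>2\<close> outside the field of order \<open>q\<close>.
  In terms of \<open>r\<close> the trace condition is a linear and a quadratic equation over the latter.\<close>

lemma ex_trace_eq_1_of_param:
  assumes b: "fr (fr (fr b)) = b" "b + fr b + fr (fr b) = 1"
    and z: "fr (fr z) = z" "fr z \<noteq> z"
    and r: "fr (fr (fr r)) = r"
    and lin: "(1 - b) * r + (1 - fr b) * fr r + (1 - fr (fr b)) * fr (fr r) = - (z + fr z)"
    and quad: "b * fr r * fr (fr r) + fr b * fr (fr r) * r + fr (fr b) * r * fr r = z * fr z"
  shows "\<exists>x. x ^ (q ^ n + 1) = 1 \<and> x \<noteq> 1 \<and> trace_Fq2 q n (x * b) = 1"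
proof (intro exI conjI)
  let ?x = "(r + fr z) / (r + z)"
  \<comment> \<open>Otherwise \<open>z\<close> would be fixed by two and by three applications of
    \<open>fr\<close>, hence by \<open>fr\<close>.\<close>
  have nz: "r + z \<noteq> 0"
  proof
    assume "r + z = 0"
    then have "r = - z"
      by (simp add: eq_neg_iff_add_eq_0)
    with r z show False
      by simp
  qed
  have nz1: "r + fr z \<noteq> 0" "fr r + z \<noteq> 0" "fr (fr r) + z \<noteq> 0"
    using nz fr_eq_0_iff[of "r + z"] fr_eq_0_iff[of "fr (r + z)"] fr_eq_0_iff[of "fr (fr (r + z))"]
      fr_eq_0_iff[of "fr (fr (fr (r + z)))"] by (simp_all add: r z del: fr_eq_0_iff)
  show "?x ^ (q ^ n + 1) = 1"
    unfolding norm_fr using nz nz1(1) by (simp add: r z)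
  show "?x \<noteq> 1"
    using nz z(2) by simp
  show "trace_Fq2 q n (?x * b) = 1"
    using sum_Moebius_eq_1[OF b(2) lin quad nz nz1(2,3)]
    by (simp add: trace_fr r z b add_ac)
qed


text \<open>\<open>r0\<close> solves the linear equation because the conjugates of \<open>b\<close>
  sum to 1; \<open>b \<noteq> 1\<close> makes its denominator nonzero. In characteristic 2,
  \<open>b\<close> solves the homogeneous equation, and a square root supplies the multiple of
  \<open>b\<close> that the quadratic equation asks for.\<close>

lemma ex_trace_eq_1_even:
  assumes "even q" and b: "fr (fr (fr b)) = b" "b + fr b + fr (fr b) = 1" "b \<noteq> 1"
  shows "\<exists>x. x ^ (q ^ n + 1) = 1 \<and> x \<noteq> 1 \<and> trace_Fq2 q n (x * b) = 1"
proof -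
  have two: "x + x = 0" for x :: 'a
    using two_eq_0[OF assms(1)] by (metis mult_2 mult_zero_left)
  have minus: "- x = x" for x :: 'a
    using two[of x] by (metis minus_unique)
  define z where "z = unit_root"
  have z: "fr (fr z) = z" "fr z * z = 1" "fr z \<noteq> z"
    using unit_root by (auto simp: z_def)
  define \<theta> where "\<theta> = z + fr z"
  have \<theta>: "fr \<theta> = \<theta>"
    by (simp add: \<theta>_def z add.commute)
  have nz: "1 - b \<noteq> 0" "1 - fr b \<noteq> 0" "1 - fr (fr b) \<noteq> 0"
    using b(3) fr_eq_iff[of 1 b] fr_eq_iff[of 1 "fr b"] by auto
  define r0 where "r0 = \<theta> * b / (1 - b)"
  define Q where "Q r = b * fr r * fr (fr r) + fr b * fr (fr r) * r + fr (fr b) * r * fr r" for r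
  define N where "N = b * fr b * fr (fr b)"
  have "N \<noteq> 0"
    using b(2) by (auto simp: N_def)
  obtain \<gamma> where \<gamma>: "\<gamma> ^ 2 = (1 + Q r0) / N"
    using sqrt_ex[OF assms(1)] by blast
  have r0: "fr (fr (fr r0)) = r0"
    by (simp add: r0_def \<theta> b)
  have "fr (\<gamma> ^ 2) = \<gamma> ^ 2"
    unfolding \<gamma> by (simp add: Q_def N_def b r0 mult_ac add_ac)
  then have fr_\<gamma>: "fr \<gamma> = \<gamma>"
    using sqrt_unique[OF assms(1), of "fr \<gamma>" \<gamma>] by simp
  \<comment> \<open>Adding \<open>\<gamma> b\<close> preserves the linear equation and changes \<open>Q\<close> by \<open>\<gamma>\<^sup>2 N\<close>, since \<open>2 = 0\<close>.\<close>
  define r where "r = r0 + \<gamma> * b"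
  show ?thesis
  proof (rule ex_trace_eq_1_of_param[OF b(1,2) z(1,3)])
    show "fr (fr (fr r)) = r"
      by (simp add: r_def fr_\<gamma> b r0)
    have "(1 - b) * r0 = \<theta> * b" "(1 - fr b) * fr r0 = \<theta> * fr b"
        "(1 - fr (fr b)) * fr (fr r0) = \<theta> * fr (fr b)"
      using nz by (simp_all add: r0_def \<theta>)
    then have "(1 - b) * r0 + (1 - fr b) * fr r0 + (1 - fr (fr b)) * fr (fr r0) = \<theta> * (b + fr b + fr (fr b))"
      by (simp only: distrib_left)
    moreover have "(1 - b) * b + (1 - fr b) * fr b + (1 - fr (fr b)) * fr (fr b) = 0"
    proof -
      have "(1 - b) * b + (1 - fr b) * fr b + (1 - fr (fr b)) * fr (fr b)
          = (b + fr b + fr (fr b)) * (1 - (b + fr b + fr (fr b)))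
            + 2 * (b * fr b + fr b * fr (fr b) + b * fr (fr b))"
        by (simp add: algebra_simps)
      then show ?thesis
        using two_eq_0[OF assms(1)] b(2) by simp
    qed
    moreover have "(1 - b) * r + (1 - fr b) * fr r + (1 - fr (fr b)) * fr (fr r)
        = ((1 - b) * r0 + (1 - fr b) * fr r0 + (1 - fr (fr b)) * fr (fr r0))
          + \<gamma> * ((1 - b) * b + (1 - fr b) * fr b + (1 - fr (fr b)) * fr (fr b))"
      by (simp add: r_def fr_\<gamma> algebra_simps)
    ultimately show "(1 - b) * r + (1 - fr b) * fr r + (1 - fr (fr b)) * fr (fr r) = - (z + fr z)"
      by (simp only: b(2) \<theta>_def minus mult_1_right mult_zero_right add_0_right)
    have "Q r = Q r0 + \<gamma> ^ 2 * N + 2 * (\<gamma> ^ 2 * N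
        + \<gamma> * (b * fr b * fr (fr r0) + fr b * fr (fr b) * r0 + b * fr (fr b) * fr r0))"
      by (simp add: Q_def N_def r_def fr_\<gamma> b algebra_simps power2_eq_square)
    also have "\<dots> = Q r0 + (1 + Q r0)"
      using two_eq_0[OF assms(1)] \<open>N \<noteq> 0\<close> by (simp add: \<gamma>)
    also have "\<dots> = z * fr z"
      using two[of "Q r0"] z(2) by (simp add: algebra_simps)
    finally show "b * fr r * fr (fr r) + fr b * fr (fr r) * r + fr (fr b) * r * fr r = z * fr z"
      by (simp only: Q_def)
  qed
qed

text \<open>On the field of order \<open>q ^ 3\<close> this is the trace to the field of order
  \<open>q\<close>, and it agrees there with \<open>trace_Fq2 q n\<close>.\<close>

definition tr3 :: "'a \<Rightarrow> 'a" where
  "tr3 x = x + fr x + fr (fr x)"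

lemma tr3_add: "tr3 (x + y) = tr3 x + tr3 y"
  by (simp add: tr3_def)

text \<open>The last condition says that \<open>w / e\<close> is outside the field of order
  \<open>q\<close>. Without such a \<open>w\<close>, \<open>fr (g v) = k * g v\<close> would hold
  for all \<open>v\<close>: an additive polynomial of degree \<open>q ^ 5\<close> vanishing on
  \<open>q ^ 6\<close> elements.\<close>

lemma ex_trace_zero_nonproportional:
  assumes "c \<noteq> 0" and "fr (fr (fr c)) = c" and "e \<noteq> 0"
  obtains w where "fr (fr (fr w)) = w" and "tr3 (c * w) = 0" and "fr w * e \<noteq> w * fr e"
proof (rule ccontr)
  assume "\<not> thesis"
  with that have *: "fr (fr (fr w)) = w \<Longrightarrow> tr3 (c * w) = 0 \<Longrightarrow> fr w * e = w * fr e" for w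
    by blast
  define k where "k = fr c * fr e / (c * e)"
  \<comment> \<open>\<open>v + fr (fr (fr v))\<close> lies in the field of order
    \<open>q ^ 3\<close>; subtracting its image under \<open>fr\<close> makes the trace 0.\<close>
  define g where "g v = v + fr (fr (fr v)) - fr v - fr (fr (fr (fr v)))" for v
  have g: "fr (g v) = k * g v" for v
  proof -
    have "tr3 (g v) = 0"
      by (simp add: g_def tr3_def)
    have "fr (g v / c) * e = g v / c * fr e"
      by (rule *) (use assms \<open>tr3 (g v) = 0\<close> in \<open>simp_all, simp_all add: g_def\<close>)
    then show ?thesis
      using assms by (simp add: k_def field_simps)
  qed
  \<comment> \<open>The coefficients of \<open>fr (g v) - k * g v\<close>; the last one is
    \<open>- 1\<close> whatever \<open>k\<close> is.\<close>
  define a where "a i = [- k, 1 + k, - 1, - k, 1 + k, - 1] ! i" for i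
  have "a 5 = 0"
  proof (rule additive_poly_eq_0)
    show "(\<Sum>i<6. a i * x ^ (q ^ i)) = 0" for x
      using g[of x] unfolding power_q_fr
      by (simp add: a_def g_def eval_nat_numeral algebra_simps)
  qed (simp_all add: n_eq)
  then show False
    by (simp add: a_def)
qed

text \<open>The element \<open>b\<close> of trace 1 supplies the test vector
  \<open>b / k\<close>.\<close>

lemma trace_form_nondegenerate:
  assumes "fr (fr (fr k)) = k" and "fr (fr (fr b)) = b" and "tr3 b = 1"
    and "\<And>v. fr (fr (fr v)) = v \<Longrightarrow> tr3 (k * v) = 0"
  shows "k = 0"
proof (rule ccontr)
  assume "k \<noteq> 0"
  then have "k * (b / k) = b"
    by simp
  with assms(4)[of "b / k"] assms show False
    by (simp add: \<open>k \<noteq> 0\<close>)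
qed

text \<open>For odd \<open>q\<close> one can take \<open>fr z = - z\<close>. The linear equation
  becomes homogeneous and cuts out the plane \<open>W\<close>, on which \<open>Q\<close> has to take
  the value \<open>z * fr z\<close>.\<close>

lemma ex_trace_eq_1_odd:
  assumes "odd q" and b: "fr (fr (fr b)) = b" "b + fr b + fr (fr b) = 1" "b \<noteq> 1"
  shows "\<exists>x. x ^ (q ^ n + 1) = 1 \<and> x \<noteq> 1 \<and> trace_Fq2 q n (x * b) = 1"
proof -
  define Q where "Q r = tr3 (b * fr r * fr (fr r))" for r
  define B where "B r s = tr3 (b * (fr r * fr (fr s) + fr (fr r) * fr s))" for r s
  define c where "c = 1 - b"
  define W where "W = {r. fr (fr (fr r)) = r \<and> tr3 (c * r) = 0}"
  have c: "c \<noteq> 0" "fr c \<noteq> 0" "fr (fr c) \<noteq> 0" "fr (fr (fr c)) = c"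
    using b by (simp_all add: c_def)
  have b_nz: "b \<noteq> 0" "fr b \<noteq> 0" "fr (fr b) \<noteq> 0"
    using b(2) by auto
  note two = two_neq_0[OF assms(1)]
  have W_add: "r + s \<in> W" if "r \<in> W" "s \<in> W" for r s
    using that by (simp add: W_def distrib_left tr3_add)
  have W_scale: "x * r \<in> W" if "r \<in> W" "fr x = x" for x r
  proof -
    have "tr3 (c * (x * r)) = x * tr3 (c * r)"
      using that(2) by (simp add: tr3_def algebra_simps)
    with that show ?thesis
      by (simp add: W_def)
  qed
  have Q_fr: "fr (Q r) = Q r" if "r \<in> W" for r
    using that by (simp add: Q_def W_def tr3_def b algebra_simps)
  have B_fr: "fr (B r s) = B r s" if "r \<in> W" "s \<in> W" for r s
    using that by (simp add: B_def W_def tr3_def b algebra_simps)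
  have Q_add: "Q (r + s) = Q r + Q s + B r s" for r s
    by (simp add: Q_def B_def tr3_def algebra_simps)
  have Q_scale: "Q (x * r) = x ^ 2 * Q r" if "fr x = x" for x r
    using that by (simp add: Q_def tr3_def power2_eq_square algebra_simps)
  have B_scale: "B r (x * s) = x * B r s" "B (x * r) s = x * B r s" if "fr x = x" for x r s
    using that by (simp_all add: B_def tr3_def algebra_simps)
  have B_add: "B r (s + t) = B r s + B r t" for r s t
    by (simp add: B_def tr3_def algebra_simps)
  have B_self: "B r r = 2 * Q r" for r
    by (simp add: B_def Q_def tr3_def algebra_simps)

  \<comment> \<open>\<open>Q\<close> is nondegenerate on the plane \<open>W\<close>, so it contains two orthogonal vectors \<open>e\<close>, \<open>f\<close> on which \<open>Q\<close>
    does not vanish, and \<open>Q\<close> takes every value on their span.\<close>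
  have nondeg: "\<exists>w\<in>W. B s w \<noteq> 0" if "s \<in> W" "s \<noteq> 0" for s
  proof (rule ccontr)
    assume "\<not> ?thesis"
    then have zero: "B s w = 0" if "w \<in> W" for w
      using that by blast
    have s: "fr (fr (fr s)) = s" "tr3 (c * s) = 0"
      using \<open>s \<in> W\<close> by (simp_all add: W_def)
    \<comment> \<open>\<open>g\<close> represents the functional \<open>B s\<close> by the trace
      form. It vanishes on \<open>W\<close>, the kernel of the functional of \<open>c\<close>, so
      \<open>h = g / c\<close> must lie in the field of order \<open>q\<close>.\<close>
    define g where "g = fr b * fr (fr s) + fr (fr b) * fr s"
    define h where "h = g / c"
    have g: "fr (fr (fr g)) = g"
      by (simp add: g_def b s)
    have h: "fr (fr (fr h)) = h"
      by (simp add: h_def g c)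
    have Bg: "B s w = tr3 (g * w)" if "fr (fr (fr w)) = w" for w
      using that by (simp add: B_def g_def tr3_def b s algebra_simps)
    have "fr h - h = 0"
    proof (rule trace_form_nondegenerate[of _ b])
      fix v assume v: "fr (fr (fr v)) = v"
      \<comment> \<open>As \<open>fr u = v\<close>, invariance of the trace under \<open>fr\<close>
        turns \<open>tr3 (h * (u - fr u))\<close> into \<open>tr3 ((fr h - h) * v)\<close>.\<close>
      define u where "u = fr (fr v)"
      define w where "w = (u - fr u) / c"
      have u: "fr u = v" "fr v = fr v" "fr (fr (fr u)) = u"
        by (simp_all add: u_def v)
      have "w \<in> W"
        using c(1) by (simp add: W_def w_def u_def v c tr3_def)
      then have "tr3 (g * w) = 0"
        using zero Bg by (simp add: W_def)
      then have "tr3 (h * (u - fr u)) = 0"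
        by (simp add: h_def w_def)
      then show "tr3 ((fr h - h) * v) = 0"
        by (simp add: tr3_def u_def v h algebra_simps)
    qed (use b h in \<open>simp_all add: tr3_def\<close>)
    then have fr_h: "fr h = h"
      by simp
    have gh: "g = h * c"
      using c(1) by (simp add: h_def)
    have e0: "fr b * (fr (fr s) - h) + fr (fr b) * (fr s - h) = 0"
    proof -
      have "c = fr b + fr (fr b)"
        unfolding c_def b(2)[symmetric] by simp
      with gh show ?thesis
        by (simp add: g_def algebra_simps)
    qed
    have e1: "fr (fr b) * (s - h) + b * (fr (fr s) - h) = 0"
      using arg_cong[OF e0, of fr] by (simp add: b s fr_h)
    have e2: "b * (fr s - h) + fr b * (s - h) = 0"
      using arg_cong[OF e1, of fr] by (simp add: b s fr_h)
    \<comment> \<open>This combination of the three conjugate equations isolates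
      \<open>s - h\<close>. Then \<open>s = h\<close>, and membership in \<open>W\<close> reads
      \<open>2 * h = 0\<close>.\<close>
    have "2 * (fr b * fr (fr b) * (s - h)) = fr b * (fr (fr b) * (s - h) + b * (fr (fr s) - h))
        + fr (fr b) * (b * (fr s - h) + fr b * (s - h))
        - b * (fr b * (fr (fr s) - h) + fr (fr b) * (fr s - h))"
      by (simp add: algebra_simps)
    then have "s = h"
      using b_nz two by (simp add: e0 e1 e2)
    then have "(2 :: 'a) * h = 0"
    proof -
      have "tr3 (c * s) = 3 * h - h * (b + fr b + fr (fr b))"
        using \<open>s = h\<close> fr_h by (simp add: tr3_def c_def algebra_simps)
      also have "\<dots> = 2 * h"
        by (simp add: b(2))
      finally show ?thesis
        using s(2) by simp
    qed
    with two \<open>s = h\<close> \<open>s \<noteq> 0\<close> show False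
      by simp
  qed

  obtain e where e: "e \<in> W" "Q e \<noteq> 0"
  proof -
    obtain s where "s \<in> W" "fr s * 1 \<noteq> s * fr 1"
      using ex_trace_zero_nonproportional[OF c(1,4), of 1] unfolding W_def by auto
    moreover from this have "s \<noteq> 0"
      by auto
    ultimately obtain w where "w \<in> W" "B s w \<noteq> 0" "s \<in> W"
      using nondeg by blast
    \<comment> \<open>If \<open>Q s = Q w = 0\<close>, then
      \<open>Q (s + w) = B s w \<noteq> 0\<close>.\<close>
    then show ?thesis
      using that[of s] that[of w] that[of "s + w"] Q_add[of s w] W_add by fastforce
  qed
  define proj where "proj w = w + - (B e w / (2 * Q e)) * e" for w
  have coef: "fr (- (B e w / (2 * Q e))) = - (B e w / (2 * Q e))" if "w \<in> W" for w
    using B_fr[OF e(1) that] Q_fr[OF e(1)] by simp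
  have proj_W: "proj w \<in> W" if "w \<in> W" for w
    unfolding proj_def by (intro W_add W_scale coef that e)
  have B_proj: "B e (proj w) = 0" if "w \<in> W" for w
    unfolding proj_def B_add B_scale(1)[OF coef[OF that]] B_self using e(2) two by simp
  obtain f where f: "f \<in> W" "B e f = 0" "Q f \<noteq> 0"
  proof -
    have "e \<noteq> 0"
      using e(2) by (auto simp: Q_def tr3_def)
    then obtain w0 where w0: "w0 \<in> W" "fr w0 * e \<noteq> w0 * fr e"
      using ex_trace_zero_nonproportional[OF c(1,4), of e] unfolding W_def by auto
    define f0 where "f0 = proj w0"
    have f0: "f0 \<in> W" "B e f0 = 0"
      using proj_W B_proj w0(1) by (simp_all add: f0_def)
    have "f0 \<noteq> 0"
    proof
      assume "f0 = 0"
      then have w0_eq: "w0 = B e w0 / (2 * Q e) * e"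
        by (simp add: f0_def proj_def)
      have "fr (B e w0 / (2 * Q e)) = B e w0 / (2 * Q e)"
        using coef[OF w0(1)] by simp
      then have "fr w0 = B e w0 / (2 * Q e) * fr e"
        using w0_eq by (metis fr_simps(6))
      then have "fr w0 * e = w0 * fr e"
        using w0_eq by (metis mult.assoc mult.commute)
      with w0(2) show False ..
    qed
    then obtain w where w: "w \<in> W" "B f0 w \<noteq> 0"
      using nondeg f0(1) by blast
    have "B f0 e = 0"
      using f0(2) by (simp add: B_def algebra_simps)
    then have "B f0 (proj w) \<noteq> 0"
      unfolding proj_def B_add B_scale(1)[OF coef[OF w(1)]] using w(2) by simp
    \<comment> \<open>\<open>Q\<close> is nonzero at one of \<open>f0\<close>, \<open>proj w\<close>
      and their sum, all of which are orthogonal to \<open>e\<close>.\<close>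
    then show ?thesis
      using that[of f0] that[of "proj w"] that[of "f0 + proj w"] Q_add[of f0 "proj w"]
        f0 proj_W[OF w(1)] B_proj[OF w(1)] W_add B_add by fastforce
  qed

  define z where "z = unit_root - fr unit_root"
  have z: "fr z = - z" "fr (fr z) = z"
    using unit_root(3) by (simp_all add: z_def)
  have "z \<noteq> 0"
    using unit_root(1,2) by (auto simp: z_def)
  then have z_ne: "fr z \<noteq> z"
    using z(1) two by (metis add_eq_0_iff mult_2 mult_eq_0_iff)
  let ?K = "{x. fr x = x}"
  obtain x y where xy: "x \<in> ?K" "y \<in> ?K" "Q e * x ^ 2 + Q f * y ^ 2 = z * fr z"
    by (rule binary_diagonal_form_universal[of ?K "Q e" "Q f" "z * fr z"])
      (use Q_fr e f z in auto)
  define r where "r = x * e + y * f"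
  have "r \<in> W"
    using xy e f by (auto simp: r_def intro!: W_add W_scale)
  have "Q r = z * fr z"
  proof -
    have "Q r = x ^ 2 * Q e + y ^ 2 * Q f + x * (y * B e f)"
      using xy by (simp add: r_def Q_add Q_scale B_scale)
    with xy(3) f(2) show ?thesis
      by (simp add: mult.commute)
  qed
  show ?thesis
  proof (rule ex_trace_eq_1_of_param[OF b(1,2) z(2) z_ne])
    show "fr (fr (fr r)) = r"
      using \<open>r \<in> W\<close> by (simp add: W_def)
    then show "b * fr r * fr (fr r) + fr b * fr (fr r) * r + fr (fr b) * r * fr r = z * fr z"
      using \<open>Q r = z * fr z\<close> by (simp add: Q_def tr3_def)
    show "(1 - b) * r + (1 - fr b) * fr r + (1 - fr (fr b)) * fr (fr r) = - (z + fr z)"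
      using \<open>r \<in> W\<close> by (simp add: W_def c_def tr3_def z)
  qed
qed

end

section \<open>Totally singular subspaces\<close>

context singer_setting
begin

lemma Fq2_closed:
  assumes "a \<in> Fq2 q" "b \<in> Fq2 q"
  shows "(a :: 'a) + b \<in> Fq2 q" "a - b \<in> Fq2 q" "a * b \<in> Fq2 q" "a / b \<in> Fq2 q"
  using assms by (simp_all add: Fq2_def frob_add frob_diff power_mult_distrib power_divide)

lemma Fq2_0_1 [simp]: "0 \<in> Fq2 q" "1 \<in> Fq2 q"
  using q_pos by (simp_all add: Fq2_def power_0_left)

text \<open>An odd power of the \<open>q\<close>-Frobenius acts on the field of order
  \<open>q ^ 2\<close> like the first power; this makes \<open>herm\<close> Hermitian.\<close>

lemma Fq2_conj: "a ^ (q ^ n) = a ^ q" if "a \<in> Fq2 q" for a :: 'a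
proof -
  obtain k where "n = 2 * k + 1"
    using odd_n by (elim oddE)
  then have "a ^ (q ^ n) = (a ^ (q ^ (2 * k))) ^ (q ^ 1)"
    by (simp only: power_q_power_q)
  then show ?thesis
    using that by (simp add: Fq2_power)
qed

lemma herm_add_left: "herm q n (u + v) w = herm q n u w + herm q n v (w :: 'a \<times> 'a)"
  by (simp add: herm_def distrib_right trace_add)

lemma herm_add_right: "herm q n u (v + w) = herm q n u v + herm q n u (w :: 'a \<times> 'a)"
proof -
  have "(fst v + fst w) ^ q = fst v ^ q + fst w ^ q"
    using frob_add[of "fst v" "fst w" 1] by simp
  then show ?thesis
    by (simp add: herm_def frob_add distrib_left trace_add)
qed

lemma herm_scale_left: "c \<in> Fq2 q \<Longrightarrow> herm q n (scale_vec c u) v = c * herm q n u (v :: 'a \<times> 'a)"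
  by (simp add: herm_def scale_vec_def right_diff_distrib mult.assoc trace_scale)

lemma herm_scale_right:
  assumes "c \<in> Fq2 q"
  shows "herm q n u (scale_vec c v) = c ^ q * herm q n u (v :: 'a \<times> 'a)"
proof -
  have "c ^ q \<in> Fq2 q"
    using assms by (simp add: Fq2_def flip: power_mult) (simp add: power_mult mult.commute[of q])
  moreover have "snd u * (c * snd v) ^ (q ^ n) = c ^ q * (snd u * snd v ^ (q ^ n))"
    unfolding power_mult_distrib Fq2_conj[OF assms] by (rule mult.left_commute)
  ultimately have "trace_Fq2 q n (snd u * (c * snd v) ^ (q ^ n)) = c ^ q * trace_Fq2 q n (snd u * snd v ^ (q ^ n))"
    by (simp only: trace_scale)
  then show ?thesis
    unfolding herm_def scale_vec_def fst_conv snd_conv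
    by (simp only: power_mult_distrib[of c "fst v"] right_diff_distrib mult.left_commute)
qed

lemma herm_swap:
  assumes "fst u \<in> Fq2 q" "fst v \<in> Fq2 q"
  shows "herm q n v u = herm q n u (v :: 'a \<times> 'a) ^ q"
proof -
  define x where "x = snd u * snd v ^ (q ^ n)"
  have "trace_Fq2 q n x ^ q = trace_Fq2 q n x ^ (q ^ n)"
    using Fq2_conj trace_in_Fq2 by metis
  also have "\<dots> = trace_Fq2 q n (x ^ (q ^ n))"
    by (simp only: trace_Fq2_def frob_sum power_q_power_q add.commute)
  also have "x ^ (q ^ n) = snd v * snd u ^ (q ^ n)"
    by (simp only: x_def power_mult_distrib power_q_power_q frob_full[unfolded mult_2] mult.commute)
  finally have "trace_Fq2 q n (snd v * snd u ^ (q ^ n)) = trace_Fq2 q n x ^ q" ..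
  moreover have "fst v * fst u ^ q = (fst u * fst v ^ q) ^ q"
    using assms by (simp add: Fq2_def power_mult_distrib power2_eq_square flip: power_mult)
  moreover have "(fst u * fst v ^ q - trace_Fq2 q n x) ^ q = (fst u * fst v ^ q) ^ q - trace_Fq2 q n x ^ q"
    using frob_diff[of _ _ 1] by simp
  ultimately show ?thesis
    by (simp add: herm_def x_def)
qed

text \<open>Serves twice: a maximal subspace absorbs every singular vector perpendicular to it, and
  two perpendicular points span a totally singular subspace.\<close>

lemma totally_singular_extend:
  fixes v :: "'a \<times> 'a"
  assumes U: "totally_singular q n U" and v: "v \<in> herm_space q" "herm q n v v = 0"
    and perp: "\<And>u. u \<in> U \<Longrightarrow> herm q n u v = 0"
  shows "totally_singular q n {u + scale_vec c v | u c. u \<in> U \<and> c \<in> Fq2 q}" (is "totally_singular q n ?W")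
    and "U \<subseteq> {u + scale_vec c v | u c. u \<in> U \<and> c \<in> Fq2 q}"
    and "v \<in> {u + scale_vec c v | u c. u \<in> U \<and> c \<in> Fq2 q}"
proof -
  have U': "U \<subseteq> herm_space q" "0 \<in> U" "\<And>u u'. u \<in> U \<Longrightarrow> u' \<in> U \<Longrightarrow> u + u' \<in> U"
      "\<And>c u. c \<in> Fq2 q \<Longrightarrow> u \<in> U \<Longrightarrow> scale_vec c u \<in> U"
      "\<And>u u'. u \<in> U \<Longrightarrow> u' \<in> U \<Longrightarrow> herm q n u u' = 0"
    using U by (auto simp: totally_singular_def Fq2_subspace_def)
  have perp': "herm q n v u = 0" if "u \<in> U" for u
    using herm_swap[of u v] perp[OF that] U'(1) that v(1) q_pos
    by (auto simp: herm_space_def power_0_left)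
  show sub: "U \<subseteq> ?W"
  proof
    fix u assume "u \<in> U"
    then show "u \<in> ?W"
      by (intro CollectI exI[of _ u] exI[of _ 0] conjI) (simp_all add: scale_vec_def prod_eq_iff)
  qed
  show "v \<in> ?W"
    using U'(2) by (intro CollectI exI[of _ "0 :: 'a \<times> 'a"] exI[of _ "1 :: 'a"] conjI)
      (simp_all add: scale_vec_def)
  have I: "w \<in> ?W" if "w = u + scale_vec c v" "u \<in> U" "c \<in> Fq2 q" for w u c
    using that by (intro CollectI exI[of _ u] exI[of _ c] conjI)
  have E: thesis if "w \<in> ?W" "\<And>u c. w = u + scale_vec c v \<Longrightarrow> u \<in> U \<Longrightarrow> c \<in> Fq2 q \<Longrightarrow> thesis"
    for w thesis
    using that(1) by (elim CollectE exE conjE) (rule that(2))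
  have "?W \<subseteq> herm_space q"
  proof
    fix w assume "w \<in> ?W"
    then show "w \<in> herm_space q"
    proof (rule E)
      fix u c assume "w = u + scale_vec c v" "u \<in> U" "c \<in> Fq2 q"
      moreover from this have "fst u \<in> Fq2 q"
        using U'(1) by (auto simp: herm_space_def)
      ultimately show "w \<in> herm_space q"
        using v(1) Fq2_closed(1)[of "fst u" "c * fst v"] Fq2_closed(3)[of c "fst v"]
        by (simp add: herm_space_def mem_Times_iff scale_vec_def)
    qed
  qed
  moreover have "w + w' \<in> ?W" if "w \<in> ?W" "w' \<in> ?W" for w w'
  proof (rule E[OF that(1)], rule E[OF that(2)])
    fix u c u' c' assume *: "w = u + scale_vec c v" "u \<in> U" "c \<in> Fq2 q"
        "w' = u' + scale_vec c' v" "u' \<in> U" "c' \<in> Fq2 q"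
    have "w + w' = (u + u') + scale_vec (c + c') v"
      unfolding *(1,4) by (simp add: scale_vec_def prod_eq_iff algebra_simps)
    then show "w + w' \<in> ?W"
      by (rule I) (rule U'(3)[OF *(2,5)], rule Fq2_closed(1)[OF *(3,6)])
  qed
  moreover have "scale_vec a w \<in> ?W" if "w \<in> ?W" "a \<in> Fq2 q" for a w
  proof (rule E[OF that(1)])
    fix u c assume *: "w = u + scale_vec c v" "u \<in> U" "c \<in> Fq2 q"
    have "scale_vec a w = scale_vec a u + scale_vec (a * c) v"
      unfolding *(1) by (simp add: scale_vec_def prod_eq_iff algebra_simps)
    then show "scale_vec a w \<in> ?W"
      by (rule I) (rule U'(4)[OF that(2) *(2)], rule Fq2_closed(3)[OF that(2) *(3)])
  qed
  moreover have "herm q n w w' = 0" if "w \<in> ?W" "w' \<in> ?W" for w w'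
  proof (rule E[OF that(1)], rule E[OF that(2)])
    fix u c u' c' assume *: "w = u + scale_vec c v" "u \<in> U" "c \<in> Fq2 q"
        "w' = u' + scale_vec c' v" "u' \<in> U" "c' \<in> Fq2 q"
    then show "herm q n w w' = 0"
      by (simp add: herm_add_left herm_add_right herm_scale_left herm_scale_right U'(5) perp perp' v(2))
  qed
  moreover have "0 \<in> ?W"
    by (rule subsetD[OF sub U'(2)])
  ultimately show "totally_singular q n ?W"
    unfolding totally_singular_def Fq2_subspace_def by (intro conjI ballI)
qed

lemma mem_maximal_totally_singularI:
  fixes v :: "'a \<times> 'a"
  assumes M: "maximal_totally_singular q n M" and "v \<in> herm_space q" "herm q n v v = 0"
    and "\<And>u. u \<in> M \<Longrightarrow> herm q n u v = 0"
  shows "v \<in> M"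
  using totally_singular_extend[of M v] assms unfolding maximal_totally_singular_def by blast

lemma ex_maximal_totally_singular:
  assumes "totally_singular q n (U :: ('a \<times> 'a) set)"
  obtains M where "maximal_totally_singular q n M" and "U \<subseteq> M"
proof -
  have "finite {U :: ('a \<times> 'a) set. totally_singular q n U}"
    by simp
  from finite_has_maximal2[OF this, of U] assms that show ?thesis
    unfolding maximal_totally_singular_def by (metis mem_Collect_eq)
qed

lemma totally_singular_0: "totally_singular q n {0 :: 'a \<times> 'a}"
  using q_pos by (simp add: totally_singular_def Fq2_subspace_def herm_space_def herm_def scale_vec_def
      prod_eq_iff mem_Times_iff)

section \<open>Affine points and the orbit\<close>

lemma herm_affine: "herm q n (1, x) (1, y) = 1 - trace_Fq2 q n (x * y ^ (q ^ n) :: 'a)"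
  by (simp add: herm_def)

lemma affine_in_herm_space [simp]: "(1, x :: 'a) \<in> herm_space q"
  by (simp add: herm_space_def)

lemma mem_proj_point: "(v :: 'a \<times> 'a) \<in> proj_point q v"
  by (auto simp: proj_point_def scale_vec_def intro!: exI[of _ 1])

lemma proj_point_affine_eq_iff: "proj_point q (1, x :: 'a) = proj_point q (1, y) \<longleftrightarrow> x = y"
proof
  assume "proj_point q (1, x) = proj_point q (1, y)"
  with mem_proj_point[of "(1, x)"] have "(1, x) \<in> proj_point q (1, y)"
    by (simp only:)
  then show "x = y"
    by (auto simp: proj_point_def scale_vec_def)
qed simp

lemma proj_point_affine_subset_iff:
  assumes "maximal_totally_singular q n (M :: ('a \<times> 'a) set)"
  shows "proj_point q (1, x) \<subseteq> M \<longleftrightarrow> (1, x) \<in> M"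
  using assms mem_proj_point[of "(1, x)"]
  unfolding maximal_totally_singular_def totally_singular_def Fq2_subspace_def
  by (auto simp: proj_point_def)

lemma proj_point_affine_hermitian_iff:
  "proj_point q (1, x) \<in> hermitian_points q n \<longleftrightarrow> trace_Fq2 q n (x * x ^ (q ^ n) :: 'a) = 1"
proof
  assume "proj_point q (1, x) \<in> hermitian_points q n"
  then obtain v where v: "proj_point q (1, x) = proj_point q v" "herm q n v v = 0"
    by (auto simp: hermitian_points_def)
  from mem_proj_point[of "(1, x)"] obtain c where "c \<in> Fq2 q" "(1, x) = scale_vec c v"
    unfolding v(1) by (auto simp: proj_point_def)
  then have "herm q n (1, x) (1, x) = 0"
    by (simp add: herm_scale_left herm_scale_right v(2))
  then show "trace_Fq2 q n (x * x ^ (q ^ n)) = 1"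
    by (simp add: herm_affine)
next
  assume "trace_Fq2 q n (x * x ^ (q ^ n)) = 1"
  then show "proj_point q (1, x) \<in> hermitian_points q n"
    unfolding hermitian_points_def
    by (intro CollectI exI[of _ "(1, x)"] conjI) (simp_all add: herm_affine prod_eq_iff)
qed

lemma orbit_points_eq:
  "orbit_points q n \<omega> y = {proj_point q (1, x * y) | x. x ^ (q ^ n + 1) = 1}" (is "_ = ?R")
proof
  show "orbit_points q n \<omega> y \<subseteq> ?R"
    using omega_power_root unfolding orbit_points_def by blast
  show "?R \<subseteq> orbit_points q n \<omega> y"
  proof
    fix P assume "P \<in> ?R"
    then obtain x where x: "P = proj_point q (1, x * y)" "x ^ (q ^ n + 1) = 1"
      by blast
    from x(2) obtain i where "i \<le> q ^ n" "x = \<omega> ^ i"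
      by (rule root_of_unity_eq_omega_power)
    with x(1) show "P \<in> orbit_points q n \<omega> y"
      unfolding orbit_points_def by blast
  qed
qed

lemma orbit_points_eq_1:
  assumes "y ^ (q ^ n + 1) = 1"
  shows "orbit_points q n \<omega> y = orbit_points q n \<omega> 1"
proof -
  have y: "y \<noteq> 0"
    using assms by (metis power_0_left zero_neq_one add_is_0)
  have *: "(\<exists>x. x ^ (q ^ n + 1) = 1 \<and> z = x * y) \<longleftrightarrow> z ^ (q ^ n + 1) = 1" for z
  proof
    assume "z ^ (q ^ n + 1) = 1"
    then have "(z / y) ^ (q ^ n + 1) = 1"
      unfolding power_divide assms by simp
    with y show "\<exists>x. x ^ (q ^ n + 1) = 1 \<and> z = x * y"
      by (intro exI[of _ "z / y"]) simp
  next
    assume "\<exists>x. x ^ (q ^ n + 1) = 1 \<and> z = x * y"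
    then show "z ^ (q ^ n + 1) = 1"
      unfolding power_mult_distrib using assms by (auto simp only: power_mult_distrib mult_1_left)
  qed
  show ?thesis
    unfolding orbit_points_eq mult_1_right
  proof (rule Collect_cong)
    fix P
    show "(\<exists>x. P = proj_point q (1, x * y) \<and> x ^ (q ^ n + 1) = 1) \<longleftrightarrow>
        (\<exists>x. P = proj_point q (1, x) \<and> x ^ (q ^ n + 1) = 1)"
      using * by metis
  qed
qed

text \<open>Otherwise \<open>(1, y)\<close> and \<open>(1, x * y)\<close> are perpendicular, and a
  maximal totally singular subspace through both contains two points of the orbit.\<close>

lemma ovoid_imp_trace_neq_1:
  assumes ovoid: "ovoid q n (orbit_points q n \<omega> y)"
    and y: "trace_Fq2 q n (y * y ^ (q ^ n)) = 1"
    and x: "x ^ (q ^ n + 1) = 1" "x \<noteq> 1"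
  shows "trace_Fq2 q n (x * (y * y ^ (q ^ n))) \<noteq> 1"
proof
  assume tr: "trace_Fq2 q n (x * (y * y ^ (q ^ n))) = 1"
  let ?v = "(1, y)" and ?w = "(1, x * y)"
  have "x * y * (x * y) ^ (q ^ n) = x ^ (q ^ n + 1) * (y * y ^ (q ^ n))"
    by (simp add: power_mult_distrib mult_ac)
  then have w: "herm q n ?w ?w = 0"
    unfolding herm_affine by (simp only: x(1) mult_1_left y diff_self)
  have v: "herm q n ?v ?v = 0"
    by (simp add: herm_affine y)
  have wv: "herm q n ?w ?v = 0"
    by (simp add: herm_affine tr mult.assoc)
  let ?U = "{u + scale_vec c ?w | u c. u \<in> {0} \<and> c \<in> Fq2 q}"
  have 0: "herm q n 0 u = 0" for u :: "'a \<times> 'a"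
    by (simp add: herm_def q_pos)
  have U: "totally_singular q n ?U"
    by (rule totally_singular_extend(1)[OF totally_singular_0]) (use w 0 in auto)
  have "?w \<in> ?U"
    by (rule totally_singular_extend(3)[OF totally_singular_0]) (use w 0 in auto)
  have perp: "herm q n u ?v = 0" if "u \<in> ?U" for u
  proof -
    from that obtain c where "c \<in> Fq2 q" "u = 0 + scale_vec c ?w"
      by blast
    then show ?thesis
      by (simp only: herm_add_left herm_scale_left 0 wv mult_zero_right add_0)
  qed
  let ?U' = "{u + scale_vec c ?v | u c. u \<in> ?U \<and> c \<in> Fq2 q}"
  note ext = totally_singular_extend[OF U affine_in_herm_space v perp]
  obtain M where M: "maximal_totally_singular q n M" "?U' \<subseteq> M"
    by (rule ex_maximal_totally_singular[OF ext(1)])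
  have "?w \<in> M"
    by (rule subsetD[OF M(2) subsetD[OF ext(2) \<open>?w \<in> ?U\<close>]])
  moreover have "?v \<in> M"
    by (rule subsetD[OF M(2) ext(3)])
  ultimately have sub: "proj_point q ?v \<subseteq> M" "proj_point q ?w \<subseteq> M"
    by (simp_all only: proj_point_affine_subset_iff[OF M(1)])
  have "\<exists>!P. P \<in> orbit_points q n \<omega> y \<and> P \<subseteq> M"
    using ovoid M(1) unfolding ovoid_def by blast
  moreover have "proj_point q ?v \<in> orbit_points q n \<omega> y"
    unfolding orbit_points_eq by (rule CollectI, rule exI[of _ 1]) simp
  moreover have "proj_point q ?w \<in> orbit_points q n \<omega> y"
    unfolding orbit_points_eq using x(1) by blast
  ultimately have "proj_point q ?v = proj_point q ?w"
    using sub by blast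
  then have "y = x * y"
    by (simp only: proj_point_affine_eq_iff)
  moreover have "y \<noteq> 0"
    using y q_pos by auto
  ultimately show False
    using x(2) by simp
qed

end

section \<open>The ovoid in even characteristic\<close>

lemma eq_neg_diff_of_sum_eq_0: "a + b + c = 0 \<Longrightarrow> c = - a - (b :: 'b::ab_group_add)"
  by (simp add: eq_neg_iff_add_eq_0 algebra_simps)

text \<open>The triples \<open>f, g, - f - g\<close> and \<open>s, t, - s - t\<close> stand for the
  conjugates of two elements of trace 0. In characteristic 2 their inner product is a determinant,
  so orthogonality means proportionality.\<close>

lemma char_2_cross_eq:
  fixes f g s t :: "'b::comm_ring_1"
  assumes "2 = (0 :: 'b)" and "f * s + g * t + (- f - g) * (- s - t) = 0"
  shows "g * s = f * t"
proof -
  have "g * s - f * t = (f * s + g * t + (- f - g) * (- s - t)) - 2 * (f * s + g * t + f * t)"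
    by (simp add: algebra_simps)
  then show ?thesis
    using assms by simp
qed

context singer_cubic
begin

lemma trace_mult: "fr (fr a) = a \<Longrightarrow> trace_Fq2 q n (a * x) = a * trace_Fq2 q n x"
  by (simp add: trace_scale Fq2_fr)

lemma trace_1_even: "even q \<Longrightarrow> trace_Fq2 q n 1 = (1 :: 'a)"
  using two_eq_0 by (simp add: trace_fr)

lemma trace_square_even:
  assumes "even q"
  shows "trace_Fq2 q n (x ^ 2 :: 'a) = trace_Fq2 q n x ^ 2"
proof -
  have "trace_Fq2 q n x ^ 2 = trace_Fq2 q n (x ^ 2)
      + 2 * (x * fr (fr x) + x * fr (fr (fr (fr x))) + fr (fr x) * fr (fr (fr (fr x))))"
    by (simp add: trace_fr power2_eq_square algebra_simps)
  then show ?thesis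
    using two_eq_0[OF assms] by simp
qed

text \<open>In characteristic 2 an element \<open>s\<close> of trace 0 is self-orthogonal for the trace form, so its
  orthogonal complement is spanned by \<open>1\<close> and \<open>s\<close>.\<close>

lemma trace_orthogonal_decomposition:
  assumes "even q" and s: "fr (fr (fr s)) = s" "s \<noteq> 0" "trace_Fq2 q n s = 0"
    and gs: "trace_Fq2 q n (g * s) = 0"
  obtains \<gamma> where "fr (fr \<gamma>) = \<gamma>" and "g = trace_Fq2 q n g + \<gamma> * s"
    and "trace_Fq2 q n (g * fr (fr (fr g))) = trace_Fq2 q n g * fr (trace_Fq2 q n g)"
proof -
  note two = two_eq_0[OF assms(1)]
  define \<beta> where "\<beta> = trace_Fq2 q n g"
  define f where "f = g - \<beta>"
  define \<gamma> where "\<gamma> = f / s"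
  have \<beta>: "fr (fr \<beta>) = \<beta>"
    using trace_in_Fq2 by (simp add: \<beta>_def Fq2_fr)
  have "trace_Fq2 q n \<beta> = \<beta>"
    using trace_mult[OF \<beta>, of 1] trace_1_even[OF assms(1)] by simp
  then have "trace_Fq2 q n f = 0"
    unfolding f_def trace_diff by (simp add: \<beta>_def)
  then have f: "fr (fr (fr (fr f))) = - f - fr (fr f)"
    unfolding trace_fr by (rule eq_neg_diff_of_sum_eq_0)
  have s2: "fr s = - s - fr (fr s)"
    using s(3) unfolding trace_fr s(1) by (intro eq_neg_diff_of_sum_eq_0)
  have "trace_Fq2 q n (f * s) = trace_Fq2 q n (g * s) - \<beta> * trace_Fq2 q n s"
    by (simp only: f_def left_diff_distrib trace_diff trace_mult[OF \<beta>])
  then have "trace_Fq2 q n (f * s) = 0"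
    by (simp only: gs s(3) mult_zero_right diff_self)
  then have "f * s + fr (fr f) * fr (fr s) + (- f - fr (fr f)) * fr s = 0"
    unfolding trace_fr fr_simps s(1) f .
  \<comment> \<open>A single replacement: as a rewrite rule, \<open>s2\<close> would also act inside
    \<open>fr (fr s)\<close>.\<close>
  then have "f * s + fr (fr f) * fr (fr s) + (- f - fr (fr f)) * (- s - fr (fr s)) = 0"
    by (rule subst[OF s2, of "\<lambda>u. f * s + fr (fr f) * fr (fr s) + (- f - fr (fr f)) * u = 0"])
  then have "fr (fr f) * s = f * fr (fr s)"
    by (rule char_2_cross_eq[OF two])
  then have \<gamma>: "fr (fr \<gamma>) = \<gamma>"
    using s(2) by (simp add: \<gamma>_def frac_eq_eq)
  have g: "g = \<beta> + \<gamma> * s"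
    using s(2) by (simp add: \<gamma>_def f_def)
  \<comment> \<open>The elements \<open>1\<close>, \<open>s\<close>, \<open>s ^ 2\<close> have
    traces 1, 0, 0, so only the first term contributes to the trace.\<close>
  have "g * fr (fr (fr g)) = (\<beta> * fr \<beta>) * 1 + (\<beta> * fr \<gamma> + fr \<beta> * \<gamma>) * s + (\<gamma> * fr \<gamma>) * s ^ 2"
    unfolding g using s(1) by (simp add: \<beta> \<gamma> power2_eq_square algebra_simps)
  moreover have "trace_Fq2 q n ((\<beta> * fr \<beta>) * 1) = \<beta> * fr \<beta>"
    using trace_mult[of "\<beta> * fr \<beta>" 1] \<beta> trace_1_even[OF assms(1)] by simp
  moreover have "trace_Fq2 q n ((\<beta> * fr \<gamma> + fr \<beta> * \<gamma>) * s) = 0"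
    using trace_mult[of "\<beta> * fr \<gamma> + fr \<beta> * \<gamma>" s] \<beta> \<gamma> s(3) by simp
  moreover have "trace_Fq2 q n ((\<gamma> * fr \<gamma>) * s ^ 2) = 0"
    using trace_mult[of "\<gamma> * fr \<gamma>" "s ^ 2"] \<gamma> s(3) trace_square_even[OF assms(1)] by simp
  ultimately have "trace_Fq2 q n (g * fr (fr (fr g))) = \<beta> * fr \<beta>"
    by (simp only: trace_add add_0_right)
  from that[unfolded \<beta>_def[symmetric], OF \<gamma> g this] show ?thesis .
qed

text \<open>Three applications of \<open>fr\<close> invert the conjugates \<open>u\<close>,
  \<open>v\<close>, \<open>w\<close>, so their inverses also sum to 1. Hence the second and third
  elementary symmetric functions agree and cancel in
  \<open>(1 - u) * (1 - v) * (1 - w)\<close>.\<close>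

lemma affine_singular_unique:
  assumes "u ^ (q ^ n + 1) = (1 :: 'a)" and "trace_Fq2 q n u = 1"
  shows "u = 1"
proof -
  have u: "u * fr (fr (fr u)) = 1" "u \<noteq> 0"
    using assms(1) unfolding norm_fr by auto
  define v w where "v = fr (fr u)" and "w = fr (fr (fr (fr u)))"
  have vw: "v * fr (fr (fr v)) = 1" "w * fr (fr (fr w)) = 1"
  proof -
    have "fr (fr (u * fr (fr (fr u)))) = 1" "fr (fr (fr (fr (u * fr (fr (fr u)))))) = 1"
      by (simp_all only: u(1) fr_simps)
    then show "v * fr (fr (fr v)) = 1" "w * fr (fr (fr w)) = 1"
      unfolding v_def w_def fr_simps .
  qed
  have e1: "u + v + w = 1"
    using assms(2) by (simp add: trace_fr v_def w_def)
  have "fr (fr (fr u)) + fr (fr (fr v)) + fr (fr (fr w)) = 1"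
    using arg_cong[OF e1, of "\<lambda>x. fr (fr (fr x))"] by simp
  then have "v * w + u * w + u * v = u * v * w"
    using u(1) vw by algebra
  with e1 have "(1 - u) * (1 - v) * (1 - w) = 0"
    by algebra
  then have "u = 1 \<or> v = 1 \<or> w = 1"
    by auto
  then show ?thesis
    by (auto simp: v_def w_def)
qed

lemma maximal_totally_singular_closed:
  assumes "maximal_totally_singular q n (M :: ('a \<times> 'a) set)"
  shows "\<And>a x b y. (a, x) \<in> M \<Longrightarrow> (b, y) \<in> M \<Longrightarrow> (a + b, x + y) \<in> M"
    and "\<And>c a x. fr (fr c) = c \<Longrightarrow> (a, x) \<in> M \<Longrightarrow> (c * a, c * x) \<in> M"
    and "\<And>a x. (a, x) \<in> M \<Longrightarrow> fr (fr a) = a"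
    and "\<And>a x b y. (a, x) \<in> M \<Longrightarrow> (b, y) \<in> M \<Longrightarrow> a * fr b = trace_Fq2 q n (x * fr (fr (fr y)))"
proof -
  have M: "M \<subseteq> herm_space q" "\<forall>u\<in>M. \<forall>v\<in>M. u + v \<in> M" "\<forall>c\<in>Fq2 q. \<forall>u\<in>M. scale_vec c u \<in> M"
      "\<forall>u\<in>M. \<forall>v\<in>M. herm q n u v = 0"
    using assms unfolding maximal_totally_singular_def totally_singular_def Fq2_subspace_def by blast+
  show "(a + b, x + y) \<in> M" if "(a, x) \<in> M" "(b, y) \<in> M" for a x b y
    using bspec[OF bspec[OF M(2) that(1)] that(2)] by simp
  show "(c * a, c * x) \<in> M" if "fr (fr c) = c" "(a, x) \<in> M" for c a x
    using bspec[OF bspec[OF M(3)] that(2), of c] that(1) by (simp add: Fq2_fr scale_vec_def)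
  show "fr (fr a) = a" if "(a, x) \<in> M" for a x
    using M(1) that by (auto simp: herm_space_def Fq2_fr)
  show "a * fr b = trace_Fq2 q n (x * fr (fr (fr y)))" if "(a, x) \<in> M" "(b, y) \<in> M" for a x b y
    using bspec[OF bspec[OF M(4) that(1)] that(2)] by (simp add: herm_def conj_fr) (simp add: fr_def)
qed

lemma affine_mem_of_perp:
  assumes even: "even q" and M: "maximal_totally_singular q n M" and x: "x * fr (fr (fr x)) = 1"
    and perp: "\<And>a z. (a, z) \<in> M \<Longrightarrow> a = trace_Fq2 q n (z * fr (fr (fr x)))"
  shows "(1, x) \<in> M"
proof (rule mem_maximal_totally_singularI[OF M])
  show "herm q n (1, x) (1, x) = 0"
    by (simp add: herm_affine conj_fr x trace_1_even[OF even])
  show "herm q n u (1, x) = 0" if "u \<in> M" for u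
    using perp[of "fst u" "snd u"] that by (simp add: herm_def conj_fr)
qed simp

text \<open>The cases are: \<open>M\<close> contains a nonzero vector \<open>(0, x)\<close>,
  \<open>M\<close> is spanned by one \<open>(1, y)\<close>, \<open>M\<close> is zero. In the first
  two, a square root \<open>s\<close> of the norm of \<open>x\<close> or \<open>y\<close> serves to
  build a second coordinate of norm 1.\<close>

lemma ex_root_of_unity_in_maximal:
  assumes even: "even q" and M: "maximal_totally_singular q n M"
  obtains x where "x * fr (fr (fr x)) = 1" and "(1, x) \<in> M"
proof (cases "\<exists>x. x \<noteq> 0 \<and> (0, x) \<in> M")
  case True
  note closed = maximal_totally_singular_closed[OF M]
  from True obtain x where x: "x \<noteq> 0" "(0, x) \<in> M"
    by blast
  obtain s where s: "s ^ 2 = x * fr (fr (fr x))"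
    using sqrt_ex[OF even] by blast
  have "fr (fr (fr (s ^ 2))) = s ^ 2"
    by (simp only: s) (simp add: mult.commute)
  then have "fr (fr (fr s)) ^ 2 = s ^ 2"
    by simp
  then have fr_s: "fr (fr (fr s)) = s"
    by (rule sqrt_unique[OF even])
  have "s \<noteq> 0"
    using s x(1) by auto
  have "trace_Fq2 q n s ^ 2 = 0"
    using closed(4)[OF x(2) x(2)] by (simp add: s flip: trace_square_even[OF even])
  then have tr_s: "trace_Fq2 q n s = 0"
    by simp
  have decomp: "\<exists>\<beta> \<gamma>. fr (fr \<beta>) = \<beta> \<and> fr (fr \<gamma>) = \<gamma> \<and> z = \<beta> * x / s + \<gamma> * x \<and> a * fr a = \<beta> * fr \<beta>"
    if az: "(a, z) \<in> M" for a z
  proof -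
    \<comment> \<open>Multiplication by \<open>s / x\<close>, of norm 1, preserves the form on
      second coordinates and moves \<open>x\<close> to \<open>s\<close>; the decomposition along
      \<open>s\<close> is then carried back.\<close>
    define g where "g = z * s / x"
    have "g * s = z * fr (fr (fr x))"
      using s x(1) by (simp add: g_def power2_eq_square field_simps)
    then have "trace_Fq2 q n (g * s) = 0"
      using closed(4)[OF az x(2)] by simp
    from trace_orthogonal_decomposition[OF even fr_s \<open>s \<noteq> 0\<close> tr_s this]
    obtain \<gamma> where \<gamma>: "fr (fr \<gamma>) = \<gamma>" "g = trace_Fq2 q n g + \<gamma> * s"
        "trace_Fq2 q n (g * fr (fr (fr g))) = trace_Fq2 q n g * fr (trace_Fq2 q n g)" .
    have "g * fr (fr (fr g)) = z * fr (fr (fr z)) * s ^ 2 / (x * fr (fr (fr x)))"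
      by (simp add: g_def fr_s power2_eq_square)
    also have "\<dots> = z * fr (fr (fr z))"
      using \<open>s \<noteq> 0\<close> by (simp flip: s)
    finally have "a * fr a = trace_Fq2 q n g * fr (trace_Fq2 q n g)"
      using closed(4)[OF az az] \<gamma>(3) by simp
    moreover have "z = g * x / s"
      using x(1) \<open>s \<noteq> 0\<close> by (simp add: g_def)
    then have "z = trace_Fq2 q n g * x / s + \<gamma> * x"
      using \<open>s \<noteq> 0\<close> by (subst (asm) \<gamma>(2)) (simp add: field_simps)
    moreover have "fr (fr (trace_Fq2 q n g)) = trace_Fq2 q n g"
      using trace_in_Fq2 by (simp only: Fq2_fr[symmetric])
    ultimately show ?thesis
      using \<gamma>(1) by blast
  qed
  show ?thesis
  proof (cases "\<exists>a z. a \<noteq> 0 \<and> (a, z) \<in> M")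
    case True
    then obtain a z where az: "a \<noteq> 0" "(a, z) \<in> M"
      by blast
    obtain \<beta> \<gamma> where *: "fr (fr \<beta>) = \<beta>" "fr (fr \<gamma>) = \<gamma>" "z = \<beta> * x / s + \<gamma> * x" "a * fr a = \<beta> * fr \<beta>"
      using decomp[OF az(2)] by blast
    have a: "fr (fr a) = a"
      by (rule closed(3)[OF az(2)])
    \<comment> \<open>Removing the multiple of \<open>(0, x)\<close> and dividing by
      \<open>a\<close> leaves norm 1, because
      \<open>a * fr a = \<beta> * fr \<beta>\<close>.\<close>
    have "(- \<gamma> * 0, - \<gamma> * x) \<in> M"
      using *(2) by (intro closed(2) x(2)) simp
    from closed(1)[OF az(2) this] have "(a, \<beta> * x / s) \<in> M"
      by (simp add: *(3))
    from closed(2)[OF _ this, of "1 / a"] have "(1, \<beta> * x / (a * s)) \<in> M"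
      using az(1) a by (simp add: mult.commute)
    moreover have "\<beta> * x / (a * s) * fr (fr (fr (\<beta> * x / (a * s)))) = (\<beta> * fr \<beta>) * (x * fr (fr (fr x))) / ((a * fr a) * s ^ 2)"
      by (simp add: *(1) a fr_s power2_eq_square mult_ac)
    then have "\<beta> * x / (a * s) * fr (fr (fr (\<beta> * x / (a * s)))) = 1"
      using az(1) \<open>s \<noteq> 0\<close> by (simp add: *(4)[symmetric] s[symmetric])
    ultimately show ?thesis
      by (rule that[rotated])
  next
    case False
    have norm: "x / s * fr (fr (fr (x / s))) = 1"
      using \<open>s \<noteq> 0\<close> by (simp add: fr_s s[symmetric] power2_eq_square[symmetric])
    \<comment> \<open>Here \<open>M\<close> consists of multiples of \<open>(0, x)\<close>, to which
      \<open>(1, x / s)\<close> is perpendicular as \<open>s\<close> has trace 0.\<close>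
    have "(1, x / s) \<in> M"
    proof (rule affine_mem_of_perp[OF even M norm])
      fix a z assume az: "(a, z) \<in> M"
      with False have a: "a = 0"
        by blast
      obtain \<beta> \<gamma> where *: "fr (fr \<gamma>) = \<gamma>" "z = \<beta> * x / s + \<gamma> * x" "a * fr a = \<beta> * fr \<beta>"
        using decomp[OF az] by blast
      with a have z: "z = \<gamma> * x"
        by simp
      have "z * fr (fr (fr (x / s))) = \<gamma> * (s ^ 2 / s)"
        by (simp add: z s fr_s)
      also have "\<dots> = \<gamma> * s"
        by (simp add: power2_eq_square)
      finally show "a = trace_Fq2 q n (z * fr (fr (fr (x / s))))"
        by (simp only: a trace_mult[OF *(1)] tr_s mult_zero_right)
    qed
    with norm show ?thesis
      by (rule that)
  qed
next
  case no_infinite: False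
  note closed = maximal_totally_singular_closed[OF M]
  show ?thesis
  proof (cases "\<exists>a z. a \<noteq> 0 \<and> (a, z) \<in> M")
    case True
    then obtain a z where "a \<noteq> 0" "(a, z) \<in> M"
      by blast
    with closed(2)[of "1 / a" a z] closed(3)[of a z] have z1: "(1, z / a) \<in> M"
      by simp
    define y where "y = z / a"
    have y: "(1, y) \<in> M"
      using z1 by (simp add: y_def)
    have mult: "v = b * y" if "(b, v) \<in> M" for b v
    proof -
      have "(- b * 1, - b * y) \<in> M"
        using closed(3)[OF that] by (intro closed(2) y) simp
      from closed(1)[OF that this] have "(0, v - b * y) \<in> M"
        by simp
      with no_infinite have "v - b * y = 0"
        by blast
      then show ?thesis
        by simp
    qed
    obtain s where s: "s ^ 2 = y * fr (fr (fr y))"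
      using sqrt_ex[OF even] by blast
    have "fr (fr (fr (s ^ 2))) = s ^ 2"
      by (simp only: s) (simp add: mult.commute)
    then have "fr (fr (fr s)) ^ 2 = s ^ 2"
      by simp
    then have fr_s: "fr (fr (fr s)) = s"
      by (rule sqrt_unique[OF even])
    have "trace_Fq2 q n s ^ 2 = 1 ^ 2"
      using closed(4)[OF y y] by (simp add: s flip: trace_square_even[OF even])
    then have tr_s: "trace_Fq2 q n s = 1"
      by (rule sqrt_unique[OF even])
    then have "s \<noteq> 0"
      using q_pos by auto
    then have "y \<noteq> 0"
      using s by auto
    have "s / fr (fr (fr y)) * fr (fr (fr (s / fr (fr (fr y))))) = s ^ 2 / (y * fr (fr (fr y)))"
      by (simp add: fr_s power2_eq_square mult.commute)
    then have norm: "s / fr (fr (fr y)) * fr (fr (fr (s / fr (fr (fr y))))) = 1"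
      using \<open>s \<noteq> 0\<close> by (simp flip: s)
    \<comment> \<open>\<open>y\<close> times the conjugate of this second coordinate is
      \<open>s\<close>, whose trace is 1; so the vector is perpendicular to
      \<open>(1, y)\<close>.\<close>
    have "(1, s / fr (fr (fr y))) \<in> M"
    proof (rule affine_mem_of_perp[OF even M norm])
      fix b v assume bv: "(b, v) \<in> M"
      have "v * fr (fr (fr (s / fr (fr (fr y))))) = b * s"
        using \<open>y \<noteq> 0\<close> by (simp add: mult[OF bv] fr_s)
      then show "b = trace_Fq2 q n (v * fr (fr (fr (s / fr (fr (fr y))))))"
        by (simp only: trace_mult[OF closed(3)[OF bv]] tr_s mult_1_right)
    qed
    with norm show ?thesis
      by (rule that)
  next
    case False
    have "(1, 1) \<in> M"
    proof (rule affine_mem_of_perp[OF even M])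
      fix a z assume az: "(a, z) \<in> M"
      with False have "a = 0"
        by blast
      moreover from this az no_infinite have "z = 0"
        by blast
      ultimately show "a = trace_Fq2 q n (z * fr (fr (fr 1)))"
        using q_pos by simp
    qed simp
    then show ?thesis
      by (intro that[of 1]) simp_all
  qed
qed

text \<open>For uniqueness, the quotient of the parameters of two orbit points in \<open>M\<close>
  has norm and trace 1.\<close>

lemma singer_ovoid_even:
  assumes even: "even q"
  shows "ovoid q n (orbit_points q n \<omega> 1)"
  unfolding ovoid_def
proof (intro conjI allI impI)
  show "orbit_points q n \<omega> 1 \<subseteq> hermitian_points q n"
    unfolding orbit_points_eq norm_fr
    by (auto simp: proj_point_affine_hermitian_iff conj_fr trace_1_even[OF even])
  fix M :: "('a \<times> 'a) set" assume M: "maximal_totally_singular q n M"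
  note closed = maximal_totally_singular_closed[OF M]
  obtain x where x: "x * fr (fr (fr x)) = 1" "(1, x) \<in> M"
    using ex_root_of_unity_in_maximal[OF even M] .
  show "\<exists>!P. P \<in> orbit_points q n \<omega> 1 \<and> P \<subseteq> M"
  proof (rule ex1I[of _ "proj_point q (1, x)"])
    show "proj_point q (1, x) \<in> orbit_points q n \<omega> 1 \<and> proj_point q (1, x) \<subseteq> M"
      unfolding orbit_points_eq norm_fr proj_point_affine_subset_iff[OF M] mult_1_right
      using x by blast
  next
    fix P assume "P \<in> orbit_points q n \<omega> 1 \<and> P \<subseteq> M"
    then obtain y where y: "y * fr (fr (fr y)) = 1" "P = proj_point q (1, y)" "(1, y) \<in> M"
      unfolding orbit_points_eq norm_fr mult_1_right using proj_point_affine_subset_iff[OF M] by blast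
    have nz: "x \<noteq> 0" "y \<noteq> 0"
      using x(1) y(1) by auto
    have "fr (fr (fr x)) = 1 / x"
      using x(1) nz by (simp add: field_simps)
    then have "trace_Fq2 q n (y / x) = 1"
      using closed(4)[OF y(3) x(2)] by simp
    moreover have "(y / x) ^ (q ^ n + 1) = 1"
      unfolding norm_fr using x(1) y(1) by simp
    ultimately have "y / x = 1"
      by (rule affine_singular_unique[rotated])
    with nz have "y = x"
      by simp
    with y(2) show "P = proj_point q (1, x)"
      by simp
  qed
qed

end

theorem theorem3p7:
  fixes p d q n :: nat and \<omega> y :: "'a::{field,finite}"
  assumes "prime p" and "d \<ge> 1" and "q = p ^ d"
    and "n \<ge> 3" and "odd n"
    and "CARD('a) = q ^ (2 * n)"
    and "has_mult_order \<omega> (q ^ n + 1)"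
    and "proj_point q (1, y) \<in> hermitian_points q n"
  shows "ovoid q n (orbit_points q n \<omega> y) \<longleftrightarrow>
    n = 3 \<and> even q \<and> orbit_points q n \<omega> y = orbit_points q n \<omega> 1"
proof
  interpret singer_setting p d q n \<omega>
    by standard (use assms in auto)
  assume A: "n = 3 \<and> even q \<and> orbit_points q n \<omega> y = orbit_points q n \<omega> 1"
  interpret singer_cubic p d q n \<omega>
    by unfold_locales (simp add: A)
  have "ovoid q n (orbit_points q n \<omega> 1)"
    using A by (intro singer_ovoid_even) simp
  with A show "ovoid q n (orbit_points q n \<omega> y)"
    by metis
next
  interpret singer_setting p d q n \<omega>
    by standard (use assms in auto)
  assume ovoid: "ovoid q n (orbit_points q n \<omega> y)"
  \<comment> \<open>Perpendicularity within the orbit depends on \<open>y\<close> only through this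
    norm.\<close>
  define b where "b = y * y ^ (q ^ n)"
  have b: "trace_Fq2 q n b = 1"
    using assms(8) by (simp add: proj_point_affine_hermitian_iff b_def)
  have no_root: "\<not> (\<exists>x. x ^ (q ^ n + 1) = 1 \<and> x \<noteq> 1 \<and> trace_Fq2 q n (x * b) = 1)"
    using ovoid_imp_trace_neq_1[OF ovoid] b unfolding b_def by blast
  have "n < 5"
    using ex_trace_eq_1_of_ge_5[OF _ b] no_root by (meson not_le)
  moreover have "n \<noteq> 4"
    using odd_n by auto
  ultimately have n: "n = 3"
    using n_ge by simp
  interpret singer_cubic p d q n \<omega>
    by unfold_locales (rule n)
  have fr_b: "fr (fr (fr b)) = b"
    by (simp add: b_def conj_fr mult.commute)
  have tr_b: "b + fr b + fr (fr b) = 1"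
    using b fr_b by (simp add: trace_fr add_ac)
  have "b = 1"
    using ex_trace_eq_1_even[OF _ fr_b tr_b] ex_trace_eq_1_odd[OF _ fr_b tr_b] no_root by blast
  have "even q"
  proof (rule ccontr)
    assume "odd q"
    moreover have "(2 :: 'a) = (b + fr b + fr (fr b)) - 1"
      by (simp add: \<open>b = 1\<close>)
    then have "(2 :: 'a) = 0"
      unfolding tr_b by simp
    ultimately show False
      using two_neq_0 by blast
  qed
  moreover have "y ^ (q ^ n + 1) = 1"
    using \<open>b = 1\<close> by (simp add: b_def)
  then have "orbit_points q n \<omega> y = orbit_points q n \<omega> 1"
    by (rule orbit_points_eq_1)
  ultimately show "n = 3 \<and> even q \<and> orbit_points q n \<omega> y = orbit_points q n \<omega> 1"
    using n by blast
qed

end
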